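(* Consider the problem $\min_{y,z} f(y,z)$ subject to $\sum_{i=1}^b y_i=0$ with $f=\frac1N\sum_{l=1}^N f_l$, and let $x^0$ be a feasible initial point, $f^*$ the optimal value and $\Delta_0=f(x^0)-f^*$. Let $\{x^k\}_{k\ge0}$ be the sequence generated by the stochastic pairwise coordinate descent method (described in the context) with $$\alpha_i=\frac{\sqrt{\Delta_0L}}{M\sqrt{i+1}},\qquad i\ge0,$$ and let $\bar x^k\in\arg\min_{x\in\{x^0,\dots,x^k\}}f(x)$. Then $$\mathbb{E}[f(\bar x^k)]-f^*\le O\!\left(\frac{1}{\sqrt[4]{k}}\right),$$ i.e. there is a constant $C$ independent of $k$ such that $\mathbb{E}[f(\bar x^k)]-f^*\le C k^{-1/4}$ for all $k\ge1$.
   Context: Problem. Variables are $y=(y_1,\dots,y_b)$, $z=(z_1,\dots,z_b)$ with $y_i\in\mathbb{R}^{n_y}$, $z_i\in\mathbb{R}^{n_z}$; write $x=(y,z)$, and let block $i$ be $x_i=(y_i,z_i)$. The function $f=\frac1N\sum_{l=1}^Nf_l$ is convex and continuously differentiable, each $f_l$ being differentiable with $\|\nabla f_l(x)\|\le M$ for all $x$. The problem is to minimize $f(y,z)$ subject to $\sum_{i=1}^b y_i=0$; its set of optimal solutions $X^*$ is nonempty. Block partial gradients of $f$ are Lipschitz with a common constant $L>0$: for each $i$, $\|\nabla_i f(x+U_i h)-\nabla_i f(x)\|\le L\|h\|$ for all $x,h$, where $U_i$ embeds a block-$i$ vector into the full space; likewise, for each edge $(i,j)$, the partial gradient $\nabla_{ij}f$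 with respect to $(x_i,x_j)$ is $L$-Lipschitz with respect to changes in the blocks $(x_i,x_j)$. Communication graph. $G=(V,E)$ is a connected graph on $V=\{1,\dots,b\}$; edge $(i,j)\in E$ is chosen with probability $p_{ij}=p_{ji}>0$, probabilities summing to $1$ over the (unordered) edges, and $p_{ij}=0$ for non-edges. Algorithm. At iteration $k\ge0$ draw, independently of the past and of each other, an edge $(i_k,j_k)\in E$ with probability $p_{i_kj_k}$ and an index $l_k$ uniformly from $\{1,\dots,N\}$. Let $d_{i_kj_k}$ minimize $f_{l_k}(x^k)+\langle\nabla_{i_kj_k}f_{l_k}(x^k),d_{i_kj_k}\rangle+\frac{L}{2\alpha_k}\|d_{i_kj_k}\|^2$ over $d_{i_kj_k}=(d_{i_k},d_{j_k})$ whose $y$-parts satisfy $d_{y_{i_k}}+d_{y_{j_k}}=0$, and let $x^{k+1}$ be $x^k$ with blocks $i_k,j_k$ incremented by $d_{i_k},d_{j_k}$. Equivalently $d_{y_{i_k}}=-d_{y_{j_k}}=\frac{\alpha_k}{2L}(\nabla_{y_{j_k}}f_{l_k}(x^k)-\nabla_{y_{i_k}}f_{l_k}(x^k))$, $d_{z_{i_k}}=-\frac{\alpha_k}{L}\nabla_{z_{i_k}}f_{l_k}(x^k)$, $d_{z_{j_k}}=-\frac{\alpha_k}{L}\nabla_{z_{j_k}}f_{l_k}(x^k)$. The expectation is over all random choices. Level-set radius. The paper's convention is that the quantity $R(x^0)=\max_{x:\,f(x)\le f(x^0)}\max_{x^*\in X^*}\|x-x^*\|_{\mathcal K}^*$ is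 finite, where, for $x=(y,z)$, $\|x\|_{\mathcal K}^*=\sqrt{y^\top(\mathcal L^+\otimes I_{n_y})y+z^\top(\mathcal D^{-1}\otimes I_{n_z})z}$, $\mathcal L_{ii}=\sum_{r\ne i}\frac{p_{ir}}{2L}$, $\mathcal L_{ij}=-\frac{p_{ij}}{2L}$ ($i\ne j$), $\mathcal D=\mathrm{diag}(p_1/L,\dots,p_b/L)$ with $p_i=\sum_{j\ne i}p_{ij}$, and $\mathcal L^+$ is the Moore–Penrose pseudoinverse. *)

theory Defs
  imports "HOL-Analysis.Analysis" "HOL-Probability.Probability"
begin

(* A point x = (y, z) is stored blockwise: x $ i = (y_i, z_i).  The norms and inner products of
   the product and vector types are the Euclidean ones of the full space. *)
type_synonym ('y, 'z, 'b) point = "((real ^ 'y) \<times> (real ^ 'z)) ^ 'b"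

definition grad :: "('a::real_inner \<Rightarrow> real) \<Rightarrow> 'a \<Rightarrow> 'a" where
  "grad f x = (THE D. GDERIV f x :> D)"

definition feasible :: "('y::finite, 'z::finite, 'b::finite) point set" where
  "feasible = {x. (\<Sum>i\<in>UNIV. fst (x $ i)) = 0}"

definition opt_val :: "(('y::finite, 'z::finite, 'b::finite) point \<Rightarrow> real) \<Rightarrow> real" where
  "opt_val f = (INF x\<in>feasible. f x)"

definition opt_set ::
  "(('y::finite, 'z::finite, 'b::finite) point \<Rightarrow> real) \<Rightarrow> ('y, 'z, 'b) point set" where
  "opt_set f = {x. is_arg_min f (\<lambda>u. u \<in> feasible) x}"

(* Unordered edges are two-element sets of vertices. *)
definition connected_graph :: "'b set set \<Rightarrow> bool" where
  "connected_graph E \<longleftrightarrow> (\<forall>e\<in>E. card e = 2) \<and> (\<forall>i j. (i, j) \<in> {(u, v). {u, v} \<in> E}\<^sup>*)"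

(* Edge probabilities are indexed by unordered edges: p_ij = p_ji is p {i, j}. *)
definition lap_mat :: "('b::finite set \<Rightarrow> real) \<Rightarrow> real \<Rightarrow> real ^ 'b ^ 'b" where
  "lap_mat p L = (\<chi> i j. if i = j then (\<Sum>r\<in>UNIV - {i}. p {i, r} / (2 * L))
                          else - (p {i, j} / (2 * L)))"

definition deg_mat :: "('b::finite set \<Rightarrow> real) \<Rightarrow> real \<Rightarrow> real ^ 'b ^ 'b" where
  "deg_mat p L = (\<chi> i j. if i = j then (\<Sum>r\<in>UNIV - {i}. p {i, r}) / L else 0)"

(* Moore--Penrose pseudoinverse, by the four Penrose conditions. *)
definition pinv :: "real ^ 'b ^ 'b \<Rightarrow> real ^ 'b ^ ('b::finite)" where
  "pinv A = (THE X. A ** X ** A = A \<and> X ** A ** X = X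
                  \<and> transpose (A ** X) = A ** X \<and> transpose (X ** A) = X ** A)"

(* The action of the Kronecker product of A with an identity matrix on a block vector. *)
definition kron_id :: "real ^ 'b ^ 'b \<Rightarrow> ('a::real_vector) ^ 'b \<Rightarrow> 'a ^ ('b::finite)" where
  "kron_id A v = (\<chi> i. \<Sum>j\<in>UNIV. (A $ i $ j) *\<^sub>R (v $ j))"

definition K_dual_norm ::
  "('b::finite set \<Rightarrow> real) \<Rightarrow> real \<Rightarrow> ('y::finite, 'z::finite, 'b) point \<Rightarrow> real" where
  "K_dual_norm p L x =
     (let y = (\<chi> i. fst (x $ i)); z = (\<chi> i. snd (x $ i))
      in sqrt (y \<bullet> kron_id (pinv (lap_mat p L)) y + z \<bullet> kron_id (matrix_inv (deg_mat p L)) z))"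

(* Increments are points of the full space that vanish outside the two blocks of e; hence the
   full inner product and norm agree with those of the pair of blocks, and the full sum of the
   y-parts is the sum over the pair. *)
definition pair_dirs :: "'b set \<Rightarrow> ('y::finite, 'z::finite, 'b::finite) point set" where
  "pair_dirs e = {d. (\<forall>r. r \<notin> e \<longrightarrow> d $ r = 0) \<and> (\<Sum>r\<in>e. fst (d $ r)) = 0}"

(* For a zero step size the quadratic penalty is read as infinite, so that d = 0; this is
   also the value of the closed-form update at a = 0.  It occurs only if the initial point is
   already optimal or if M = 0. *)
definition is_pair_step ::
  "real \<Rightarrow> real \<Rightarrow> (('y::finite, 'z::finite, 'b::finite) point \<Rightarrow> real) \<Rightarrow> 'b set
     \<Rightarrow> ('y, 'z, 'b) point \<Rightarrow> ('y, 'z, 'b) point \<Rightarrow> bool" where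
  "is_pair_step L a g e x d \<longleftrightarrow>
     (if a = 0 then d = 0
      else is_arg_min (\<lambda>d. g x + grad g x \<bullet> d + L / (2 * a) * (norm d)\<^sup>2) (\<lambda>d. d \<in> pair_dirs e) d)"

end

(* The step on an edge e is -(a/L) times the orthogonal projection P_e of the sampled gradient onto
   the feasible directions of e. Since (1/L) sum_e p_e P_e is the operator lap_mat on the y-parts
   and deg_mat on the z-parts, the Cauchy-Schwarz inequality for this form bounds the gap by
   K_dual_norm times the square root of the expected squared length of the projected gradient.
   The iterates may leave the level set of x0, where alone the radius is finite; by convexity the
   bound survives for the gap truncated at its initial value. The resulting recursion for the mean
   gap, divided by the step size and summed by parts, avoids the logarithm of the direct summation
   once sum_i alpha_i E[gap_i] = O(sqrt n) is known, and this follows from the recursion for the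
   mean squared gap. *)
theory Submission
  imports Defs
begin

text \<open>The fourth root is a square root of a square root. The expected descent of one step is
  proportional to the squared length of the projected gradient, hence at least to the square of the
  truncated gap. The second moments of the truncated gap sum to O(sqrt n), so their average is
  O(1/sqrt n), and passing from the square to the gap itself takes one more root. Truncation costs
  nothing in the final estimate: \<open>x0\<close> is a candidate for the best iterate, whose gap
  thus never exceeds the initial gap \<open>\<Delta>\<^sub>0\<close>. But it weakens the recursion
  for the mean gap, whose guaranteed drift no longer grows once the gap is above
  \<open>\<Delta>\<^sub>0\<close>; large gaps must be controlled otherwise. Squaring does this: for
  a gap \<open>a\<close> with truncation \<open>m\<close> the drift becomes proportional to a m^2,
  and a m^2 is bounded below by a linear function of \<open>a\<close>, while the new noise term of
  order \<alpha>^2 a is only O(\<alpha>), because along every single path the gap grows at most like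
  sqrt n.\<close>

section \<open>Processes driven by independent draws from a finite set\<close>

locale finite_noise_process = prob_space \<Omega> for \<Omega> :: "'w measure" +
  fixes S :: "'s set" and w :: "'s \<Rightarrow> real" and D :: "nat \<Rightarrow> 'w \<Rightarrow> 's"
    and X :: "nat \<Rightarrow> 'w \<Rightarrow> 'x" and x0 :: 'x and step :: "nat \<Rightarrow> 'x \<Rightarrow> 's \<Rightarrow> 'x"
  assumes finite_S: "finite S"
    and noise_indep: "indep_vars (\<lambda>_. count_space S) D UNIV"
    and noise_law: "\<And>k s. s \<in> S \<Longrightarrow> prob {\<omega> \<in> space \<Omega>. D k \<omega> = s} = w s"
    and process_0: "\<And>\<omega>. \<omega> \<in> space \<Omega> \<Longrightarrow> X 0 \<omega> = x0"
    and process_Suc: "\<And>k \<omega>. \<omega> \<in> space \<Omega> \<Longrightarrow> X (Suc k) \<omega> = step k (X k \<omega>) (D k \<omega>)"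
begin

lemma noise_measurable: "D k \<in> measurable \<Omega> (count_space S)"
  using noise_indep by (simp add: indep_vars_def)

lemma noise_in: "\<omega> \<in> space \<Omega> \<Longrightarrow> D k \<omega> \<in> S"
  using measurable_space[OF noise_measurable] by simp

primrec walk :: "nat \<Rightarrow> (nat \<Rightarrow> 's) \<Rightarrow> 'x" where
  "walk 0 h = x0"
| "walk (Suc k) h = step k (walk k h) (h k)"

lemma walk_cong: "(\<And>i. i < k \<Longrightarrow> h i = h' i) \<Longrightarrow> walk k h = walk k h'"
  by (induction k) auto

text \<open>Cutting the history off at \<open>k\<close> makes it a point of the finite product over
  \<open>{..<k}\<close>. This yields both facts needed about \<open>X k\<close>: it takes finitely
  many values, and it depends on no draw with index \<open>k\<close> or later.\<close>

lemma process_eq_walk: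
  "\<omega> \<in> space \<Omega> \<Longrightarrow> X k \<omega> = walk k (restrict (\<lambda>i. D i \<omega>) {..<k})"
proof -
  assume \<omega>: "\<omega> \<in> space \<Omega>"
  have "X k \<omega> = walk k (\<lambda>i. D i \<omega>)"
    by (induction k) (auto simp: process_0 process_Suc \<omega>)
  also have "\<dots> = walk k (restrict (\<lambda>i. D i \<omega>) {..<k})"
    by (rule walk_cong) simp
  finally show ?thesis .
qed

text \<open>A finite product of finite discrete spaces is discrete, so every set of histories is
  measurable, in particular the preimages under \<open>walk k\<close>.\<close>

lemma count_space_PiM_noise:
  "finite I \<Longrightarrow> PiM I (\<lambda>_. count_space S) = count_space (PiE I (\<lambda>_. S))"
  using finite_S by (intro count_space_PiM_finite) (auto intro: countable_finite)

lemma simple_function_process: "simple_function \<Omega> (X k)"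
proof -
  have "(\<lambda>\<omega>. restrict (\<lambda>i. D i \<omega>) {..<k}) \<in> measurable \<Omega> (PiM {..<k} (\<lambda>_. count_space S))"
    by (intro measurable_restrict noise_measurable)
  then have m: "(\<lambda>\<omega>. restrict (\<lambda>i. D i \<omega>) {..<k}) \<in> measurable \<Omega> (count_space (PiE {..<k} (\<lambda>_. S)))"
    by (simp add: count_space_PiM_noise)
  have "simple_function \<Omega> (\<lambda>\<omega>. restrict (\<lambda>i. D i \<omega>) {..<k})"
    unfolding simple_function_def
  proof (intro conjI ballI)
    show "finite ((\<lambda>\<omega>. restrict (\<lambda>i. D i \<omega>) {..<k}) ` space \<Omega>)"
      by (rule finite_subset[of _ "PiE {..<k} (\<lambda>_. S)"])
        (auto simp: noise_in finite_PiE finite_S split: if_splits)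
    show "(\<lambda>\<omega>. restrict (\<lambda>i. D i \<omega>) {..<k}) -` {h} \<inter> space \<Omega> \<in> events"
      if "h \<in> (\<lambda>\<omega>. restrict (\<lambda>i. D i \<omega>) {..<k}) ` space \<Omega>" for h
      using that by (intro measurable_sets[OF m]) (auto simp: noise_in split: if_splits)
  qed
  from simple_function_compose[OF this, of "walk k"]
  have "simple_function \<Omega> (\<lambda>\<omega>. walk k (restrict (\<lambda>i. D i \<omega>) {..<k}))"
    by (simp add: comp_def)
  then show ?thesis
    by (rule simple_function_cong[THEN iffD1, rotated]) (simp add: process_eq_walk)
qed

lemma finite_process_range: "finite (X k ` space \<Omega>)"
  using simple_function_process by (simp add: simple_function_def)

text \<open>\<open>X k\<close> is a function of the draws indexed by \<open>{..<k}\<close> and the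
  next draw is indexed by \<open>{k}\<close>; families over disjoint index sets are
  independent.\<close>

lemma prob_process_noise:
  assumes "s \<in> S"
  shows "prob {\<omega> \<in> space \<Omega>. X k \<omega> = x \<and> D k \<omega> = s} = prob {\<omega> \<in> space \<Omega>. X k \<omega> = x} * w s"
proof -
  let ?H = "PiM {..<k} (\<lambda>_. count_space S)" and ?K = "PiM {k} (\<lambda>_. count_space S)"
  let ?h = "\<lambda>\<omega>. restrict (\<lambda>i. D i \<omega>) {..<k}" and ?d = "\<lambda>\<omega>. restrict (\<lambda>i. D i \<omega>) {k}"
  let ?A = "{h \<in> PiE {..<k} (\<lambda>_. S). walk k h = x}" and ?B = "{h \<in> PiE {k} (\<lambda>_. S). h k = s}"
  have "indep_var ?H ?h ?K ?d"
    using indep_var_restrict[OF noise_indep, of "{..<k}" "{k}"] by simp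
  then have "prob ((\<lambda>\<omega>. (?h \<omega>, ?d \<omega>)) -` (?A \<times> ?B) \<inter> space \<Omega>)
      = prob (?h -` ?A \<inter> space \<Omega>) * prob (?d -` ?B \<inter> space \<Omega>)"
    by (rule indep_varD) (auto simp: count_space_PiM_noise)
  moreover have "?h -` ?A \<inter> space \<Omega> = {\<omega> \<in> space \<Omega>. X k \<omega> = x}"
    by (auto simp: process_eq_walk noise_in)
  moreover have "?d -` ?B \<inter> space \<Omega> = {\<omega> \<in> space \<Omega>. D k \<omega> = s}"
    by (auto simp: noise_in)
  moreover have "(\<lambda>\<omega>. (?h \<omega>, ?d \<omega>)) -` (?A \<times> ?B) \<inter> space \<Omega>
      = {\<omega> \<in> space \<Omega>. X k \<omega> = x \<and> D k \<omega> = s}"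
    by (auto simp: process_eq_walk noise_in)
  ultimately show ?thesis using noise_law[OF assms] by simp
qed

lemma integrable_simple: "simple_function \<Omega> h \<Longrightarrow> integrable \<Omega> (h :: 'w \<Rightarrow> real)"
  by (rule integrable_simple_function) (auto simp: emeasure_eq_measure)

lemma integrable_process: "integrable \<Omega> (\<lambda>\<omega>. h (X k \<omega>) :: real)"
  using simple_function_compose[OF simple_function_process, of h k]
  by (intro integrable_simple) (simp add: comp_def)

text \<open>This takes the place of conditioning on the past: with finitely many values and draws,
  the average over the next draw can be carried out inside the expectation by finite sums.\<close>

lemma expectation_process_Suc:
  fixes h :: "'x \<Rightarrow> real"
  shows "expectation (\<lambda>\<omega>. h (X (Suc k) \<omega>))
    = expectation (\<lambda>\<omega>. \<Sum>s\<in>S. w s * h (step k (X k \<omega>) s))"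
proof -
  let ?R = "X k ` space \<Omega>"
  let ?A = "\<lambda>x s. {\<omega> \<in> space \<Omega>. X k \<omega> = x \<and> D k \<omega> = s}"
  have setX: "{\<omega> \<in> space \<Omega>. X k \<omega> = x} \<in> events" for x
    using simple_functionD(2)[OF simple_function_process, of k "{x}"]
    by (simp add: vimage_def Int_def conj_commute)
  have setD: "{\<omega> \<in> space \<Omega>. D k \<omega> = s} \<in> events" if "s \<in> S" for s
    using measurable_sets[OF noise_measurable, of "{s}" k] that
    by (simp add: vimage_def Int_def conj_commute)
  have setA: "?A x s \<in> events" if "s \<in> S" for x s
    using sets.Int[OF setX[of x] setD[OF that]]
    by (rule back_subst[of "\<lambda>A. A \<in> events"]) auto
  have intX: "integrable \<Omega> (indicat_real {\<omega> \<in> space \<Omega>. X k \<omega> = x})" for x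
    using setX by (intro integrable_real_indicator) (auto simp: emeasure_eq_measure)
  \<comment> \<open>The atoms \<open>?A x s\<close> partition the space, so the integrand is a
    finite combination of their indicators, and the probability of each atom factors.\<close>
  have "expectation (\<lambda>\<omega>. h (X (Suc k) \<omega>))
      = expectation (\<lambda>\<omega>. \<Sum>x\<in>?R. \<Sum>s\<in>S. h (step k x s) * indicat_real (?A x s) \<omega>)"
  proof (rule Bochner_Integration.integral_cong[OF refl])
    fix \<omega> assume \<omega>: "\<omega> \<in> space \<Omega>"
    have "(\<Sum>x\<in>?R. \<Sum>s\<in>S. h (step k x s) * indicat_real (?A x s) \<omega>)
        = (\<Sum>x\<in>?R. \<Sum>s\<in>S. if s = D k \<omega> then (if x = X k \<omega> then h (step k x s) else 0) else 0)"
      using \<omega> by (intro sum.cong refl) (auto simp: indicator_def)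
    also have "\<dots> = h (step k (X k \<omega>) (D k \<omega>))"
      using \<omega> by (simp add: finite_S finite_process_range noise_in sum.delta')
    finally show "h (X (Suc k) \<omega>) = (\<Sum>x\<in>?R. \<Sum>s\<in>S. h (step k x s) * indicat_real (?A x s) \<omega>)"
      using \<omega> by (simp add: process_Suc)
  qed
  also have "\<dots> = (\<Sum>x\<in>?R. \<Sum>s\<in>S. h (step k x s) * (prob {\<omega> \<in> space \<Omega>. X k \<omega> = x} * w s))"
  proof -
    have intA: "integrable \<Omega> (indicat_real (?A x s))" if "s \<in> S" for x s
      using setA[OF that] by (intro integrable_real_indicator) (auto simp: emeasure_eq_measure)
    have "expectation (\<lambda>\<omega>. \<Sum>x\<in>?R. \<Sum>s\<in>S. h (step k x s) * indicat_real (?A x s) \<omega>)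
        = (\<Sum>x\<in>?R. \<Sum>s\<in>S. expectation (\<lambda>\<omega>. h (step k x s) * indicat_real (?A x s) \<omega>))"
      by (simp add: Bochner_Integration.integral_sum Bochner_Integration.integrable_sum intA)
    also have "\<dots> = (\<Sum>x\<in>?R. \<Sum>s\<in>S. h (step k x s) * (prob {\<omega> \<in> space \<Omega>. X k \<omega> = x} * w s))"
      by (intro sum.cong refl) (simp add: setA prob_process_noise)
    finally show ?thesis .
  qed
  also have "\<dots> = (\<Sum>x\<in>?R. (\<Sum>s\<in>S. w s * h (step k x s)) * prob {\<omega> \<in> space \<Omega>. X k \<omega> = x})"
    by (simp add: sum_distrib_left sum_distrib_right mult_ac)
  also have "\<dots> = expectation (\<lambda>\<omega>. \<Sum>x\<in>?R. (\<Sum>s\<in>S. w s * h (step k x s))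
      * indicat_real {\<omega> \<in> space \<Omega>. X k \<omega> = x} \<omega>)"
    using setX by (simp add: Bochner_Integration.integral_sum intX)
  also have "\<dots> = expectation (\<lambda>\<omega>. \<Sum>s\<in>S. w s * h (step k (X k \<omega>) s))"
  proof (rule Bochner_Integration.integral_cong[OF refl])
    fix \<omega> assume \<omega>: "\<omega> \<in> space \<Omega>"
    have "(\<Sum>x\<in>?R. (\<Sum>s\<in>S. w s * h (step k x s)) * indicat_real {\<omega> \<in> space \<Omega>. X k \<omega> = x} \<omega>)
        = (\<Sum>x\<in>?R. if x = X k \<omega> then (\<Sum>s\<in>S. w s * h (step k x s)) else 0)"
      using \<omega> by (intro sum.cong refl) (auto simp: indicator_def)
    then show "(\<Sum>x\<in>?R. (\<Sum>s\<in>S. w s * h (step k x s)) * indicat_real {\<omega> \<in> space \<Omega>. X k \<omega> = x} \<omega>)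
        = (\<Sum>s\<in>S. w s * h (step k (X k \<omega>) s))"
      using \<omega> by (simp add: finite_process_range)
  qed
  finally show ?thesis .
qed

end

section \<open>Pseudoinverse, graph Laplacian and degree matrix\<close>

lemma matrix_mul_diff_left: "((A :: real^'n^'n) - B) ** C = A ** C - B ** C"
  by (simp add: matrix_matrix_mult_def vec_eq_iff sum_subtractf algebra_simps)

lemma matrix_mul_diff_right: "(C :: real^'n^'n) ** (A - B) = C ** A - C ** B"
  by (simp add: matrix_matrix_mult_def vec_eq_iff sum_subtractf algebra_simps)

lemma matrix_mul_add_left: "((A :: real^'n^'n) + B) ** C = A ** C + B ** C"
  by (simp add: matrix_matrix_mult_def vec_eq_iff sum.distrib algebra_simps)

lemma transpose_diff: "transpose ((A :: real^'n^'m) - B) = transpose A - transpose B"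
  by (simp add: transpose_def vec_eq_iff)

lemma invertible_matrix_inv:
  assumes "invertible (A :: real^'n^'n)"
  shows "A ** matrix_inv A = mat 1" "matrix_inv A ** A = mat 1"
  using someI_ex[OF assms[unfolded invertible_def]] by (simp_all add: matrix_inv_def)

text \<open>The classical uniqueness argument: \<open>A ** Y\<close> equals
  \<open>(A ** X) ** (A ** Y)\<close>, and transposing this product of symmetric factors collapses
  it to \<open>A ** X\<close>. The same on the other side gives \<open>Y ** A = X ** A\<close>, and
  then Y = YAY = XAX = X.\<close>

lemma pinv_eqI:
  fixes A X :: "real^'n^'n::finite"
  assumes "A ** X ** A = A" "X ** A ** X = X"
    "transpose (A ** X) = A ** X" "transpose (X ** A) = X ** A"
  shows "pinv A = X"
  unfolding pinv_def
proof (rule the_equality)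
  fix Y assume Y: "A ** Y ** A = A \<and> Y ** A ** Y = Y
    \<and> transpose (A ** Y) = A ** Y \<and> transpose (Y ** A) = Y ** A"
  have "A ** Y = transpose (transpose (A ** Y))" by simp
  also have "transpose (A ** Y) = transpose (A ** X ** A ** Y)" using assms Y by simp
  also have "\<dots> = transpose ((A ** X) ** (A ** Y))" by (simp add: matrix_mul_assoc)
  also have "\<dots> = (A ** Y) ** (A ** X)" using assms Y by (simp only: matrix_transpose_mul)
  also have "\<dots> = A ** X" using Y by (simp add: matrix_mul_assoc)
  finally have AY: "A ** Y = A ** X" using assms by simp
  have "Y ** A = transpose (transpose (Y ** A))" by simp
  also have "transpose (Y ** A) = transpose (Y ** (A ** X ** A))" using assms Y by simp
  also have "\<dots> = transpose ((Y ** A) ** (X ** A))" by (simp add: matrix_mul_assoc)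
  also have "\<dots> = (X ** A) ** (Y ** A)" using assms Y by (simp only: matrix_transpose_mul)
  also have "\<dots> = X ** (A ** Y ** A)" by (simp add: matrix_mul_assoc)
  also have "\<dots> = X ** A" using Y by simp
  finally have YA: "Y ** A = X ** A" using assms by simp
  have "Y = Y ** A ** Y" using Y by simp
  also have "\<dots> = X ** (A ** Y)" using YA by (simp add: matrix_mul_assoc)
  also have "\<dots> = X ** A ** X" using AY by (simp add: matrix_mul_assoc)
  finally show "Y = X" using assms by simp
qed (use assms in simp)

text \<open>\<open>J\<close> is the orthogonal projection onto the kernel of \<open>A\<close>.
  Adding it makes \<open>A\<close> invertible without changing its action on the complement, so the
  pseudoinverse is the inverse of \<open>A + J\<close> with \<open>J\<close> subtracted
  again.\<close>

lemma mul_pinv_of_kernel_projection: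
  fixes A J :: "real^'n^'n::finite"
  assumes sym: "transpose A = A" "transpose J = J"
    and J: "J ** J = J" "A ** J = 0" and inv: "invertible (A + J)"
  shows "A ** pinv A = mat 1 - J"
proof -
  define B where "B = matrix_inv (A + J)"
  have JA: "J ** A = 0"
  proof -
    have "J ** A = transpose (A ** J)" using sym by (simp add: matrix_transpose_mul)
    then show ?thesis using J by (simp add: transpose_def vec_eq_iff)
  qed
  have B: "(A + J) ** B = mat 1" "B ** (A + J) = mat 1"
    using invertible_matrix_inv[OF inv] by (auto simp: B_def)
  have cJ: "(A + J) ** J = J" "J ** (A + J) = J"
    using J JA by (simp_all add: matrix_mul_add_left matrix_add_ldistrib)
  have BJ: "B ** J = J" by (metis B(2) cJ(1) matrix_mul_assoc matrix_mul_lid)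
  have JB: "J ** B = J" by (metis B(1) cJ(2) matrix_mul_assoc matrix_mul_rid)
  have AB: "A ** B = mat 1 - J"
  proof -
    have "A ** B + J ** B = mat 1" using B(1) by (simp add: matrix_mul_add_left)
    then show ?thesis using JB by (simp add: algebra_simps)
  qed
  have BA: "B ** A = mat 1 - J"
  proof -
    have "B ** A + B ** J = mat 1" using B(2) by (simp add: matrix_add_ldistrib)
    then show ?thesis using BJ by (simp add: algebra_simps)
  qed
  have AX: "A ** (B - J) = mat 1 - J" "(B - J) ** A = mat 1 - J"
    using AB BA J JA by (simp_all add: matrix_mul_diff_left matrix_mul_diff_right)
  have "pinv A = B - J"
  proof (rule pinv_eqI)
    show "A ** (B - J) ** A = A"
      by (simp only: AX) (simp add: JA matrix_mul_diff_left)
    show "(B - J) ** A ** (B - J) = B - J"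
      by (simp only: AX) (simp add: matrix_mul_diff_left matrix_mul_diff_right JB J)
  qed (simp_all add: AX transpose_diff sym transpose_mat)
  then show ?thesis using AX by simp
qed

lemma lap_mat_symmetric: "transpose (lap_mat p L) = lap_mat p L"
  by (simp add: lap_mat_def transpose_def vec_eq_iff insert_commute)

lemma kron_id_lap_mat:
  "kron_id (lap_mat p L) v $ i = (\<Sum>j\<in>UNIV - {i}. (p {i, j} / (2 * L)) *\<^sub>R (v $ i - v $ j))"
proof -
  have "kron_id (lap_mat p L) v $ i = (lap_mat p L $ i $ i) *\<^sub>R v $ i
      + (\<Sum>j\<in>UNIV - {i}. (lap_mat p L $ i $ j) *\<^sub>R v $ j)"
    unfolding kron_id_def by (simp add: sum.remove[of UNIV i])
  also have "(\<Sum>j\<in>UNIV - {i}. (lap_mat p L $ i $ j) *\<^sub>R v $ j)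
      = (\<Sum>j\<in>UNIV - {i}. - ((p {i, j} / (2 * L)) *\<^sub>R v $ j))"
    by (rule sum.cong) (auto simp: lap_mat_def)
  finally show ?thesis
    by (simp add: lap_mat_def sum_negf sum_subtractf scaleR_sum_left scaleR_diff_right)
qed

lemma matrix_vector_mult_eq_kron_id: "(A :: real^'n^'n::finite) *v u = kron_id A u"
  by (simp add: kron_id_def matrix_vector_mult_def)

text \<open>The Dirichlet form of the graph. The factor 2 appears because the double sum meets each
  unordered pair twice.\<close>

lemma lap_mat_quadratic_form:
  fixes u :: "real^'b::finite"
  shows "2 * (u \<bullet> (lap_mat p L *v u))
    = (\<Sum>i\<in>UNIV. \<Sum>j\<in>UNIV - {i}. p {i, j} / (2 * L) * (u $ i - u $ j)\<^sup>2)"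
proof -
  \<comment> \<open>With zero diagonal both indices run over \<open>UNIV\<close>, so the double sum
    can be swapped; \<open>q\<close> being symmetric, adding the swapped copy completes the
    squares.\<close>
  define q where "q i j = (if i = j then 0 else p {i, j} / (2 * L))" for i j
  have q_sym: "q i j = q j i" for i j by (simp add: q_def insert_commute)
  have r: "(\<Sum>j\<in>UNIV - {i}. p {i, j} / (2 * L) * t j) = (\<Sum>j\<in>UNIV. q i j * t j)" for i t
    by (rule sum.mono_neutral_cong_left) (auto simp: q_def)
  have e: "u \<bullet> (lap_mat p L *v u) = (\<Sum>i\<in>UNIV. \<Sum>j\<in>UNIV. q i j * (u $ i * (u $ i - u $ j)))"
  proof -
    have "u $ i * (lap_mat p L *v u) $ i = (\<Sum>j\<in>UNIV. q i j * (u $ i * (u $ i - u $ j)))" for i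
      using r[of i "\<lambda>j. u $ i - u $ j"]
      by (simp add: matrix_vector_mult_eq_kron_id kron_id_lap_mat sum_distrib_left mult.left_commute)
    then show ?thesis by (simp add: inner_vec_def)
  qed
  also have "\<dots> = (\<Sum>i\<in>UNIV. \<Sum>j\<in>UNIV. q j i * (u $ j * (u $ j - u $ i)))"
    by (rule sum.swap)
  also have "\<dots> = (\<Sum>i\<in>UNIV. \<Sum>j\<in>UNIV. q i j * (u $ j * (u $ j - u $ i)))"
    using q_sym by simp
  finally have "2 * (u \<bullet> (lap_mat p L *v u)) = (\<Sum>i\<in>UNIV. \<Sum>j\<in>UNIV. q i j * (u $ i * (u $ i - u $ j)))
     + (\<Sum>i\<in>UNIV. \<Sum>j\<in>UNIV. q i j * (u $ j * (u $ j - u $ i)))"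
    using e by simp
  also have "\<dots> = (\<Sum>i\<in>UNIV. \<Sum>j\<in>UNIV. q i j * (u $ i - u $ j)\<^sup>2)"
    by (simp add: sum.distrib[symmetric] power2_eq_square algebra_simps)
  finally show ?thesis using r by simp
qed

text \<open>The quadratic form vanishes at \<open>u\<close>, hence so does each of its nonnegative
  terms: \<open>u\<close> agrees at the ends of every edge, and by connectedness everywhere.\<close>

lemma lap_mat_kernel:
  fixes u :: "real^'b::finite"
  assumes "L > 0" "connected_graph E" "\<And>e. e \<in> E \<Longrightarrow> p e > 0" "\<And>e. e \<notin> E \<Longrightarrow> p e = 0"
    and u: "lap_mat p L *v u = 0"
  shows "u $ i = u $ j"
proof -
  have p: "p e \<ge> 0" for e using assms(3,4)[of e] by (cases "e \<in> E") auto
  have nn: "p {i, j} / (2 * L) * (u $ i - u $ j)\<^sup>2 \<ge> 0" for i j using p assms(1) by simp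
  have "(\<Sum>i\<in>UNIV. \<Sum>j\<in>UNIV - {i}. p {i, j} / (2 * L) * (u $ i - u $ j)\<^sup>2) = 0"
    using lap_mat_quadratic_form[of u p L] u by simp
  then have z: "p {i, j} / (2 * L) * (u $ i - u $ j)\<^sup>2 = 0" if "i \<noteq> j" for i j
    using that nn by (auto simp: sum_nonneg_eq_0_iff sum_nonneg)
  have edge: "u $ a = u $ b" if "{a, b} \<in> E" for a b
    using z[of a b] assms(1) assms(3)[OF that] by (cases "a = b") auto
  have "(i, j) \<in> {(u, v). {u, v} \<in> E}\<^sup>*" using assms(2) by (simp add: connected_graph_def)
  then show ?thesis by (induction rule: rtrancl_induct) (auto dest: edge)
qed

lemma kron_id_mult: "kron_id (A ** B) v = kron_id A (kron_id B v)"
  for v :: "('a::real_vector)^'b::finite"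
proof -
  have "kron_id (A ** B) v $ i = kron_id A (kron_id B v) $ i" for i
  proof -
    have "kron_id (A ** B) v $ i = (\<Sum>j\<in>UNIV. \<Sum>k\<in>UNIV. (A $ i $ k * B $ k $ j) *\<^sub>R v $ j)"
      by (simp add: kron_id_def matrix_matrix_mult_def scaleR_sum_left)
    also have "\<dots> = (\<Sum>k\<in>UNIV. \<Sum>j\<in>UNIV. (A $ i $ k * B $ k $ j) *\<^sub>R v $ j)"
      by (rule sum.swap)
    finally show ?thesis by (simp add: kron_id_def scaleR_sum_right)
  qed
  then show ?thesis by (simp add: vec_eq_iff)
qed

text \<open>The Laplacian annihilates exactly the constant vectors, whose orthogonal projection is
  the averaging matrix \<open>J\<close>. The Laplacian times its pseudoinverse is therefore the
  identity minus \<open>J\<close>, and \<open>J\<close> annihilates block vectors with zero sum,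
  such as the y-part of a feasible point.\<close>

lemma kron_id_lap_mat_pinv:
  fixes v :: "('a::real_vector)^'b::finite"
  assumes "L > 0" "connected_graph E" "\<And>e. e \<in> E \<Longrightarrow> p e > 0" "\<And>e. e \<notin> E \<Longrightarrow> p e = 0"
    and v: "(\<Sum>i\<in>UNIV. v $ i) = 0"
  shows "kron_id (lap_mat p L) (kron_id (pinv (lap_mat p L)) v) = v"
proof -
  define J :: "real^'b^'b" where "J = (\<chi> i j. 1 / real CARD('b))"
  define A where "A = lap_mat p L"
  have tJ: "transpose J = J" by (simp add: J_def transpose_def vec_eq_iff)
  have JJ: "J ** J = J" by (simp add: J_def matrix_matrix_mult_def vec_eq_iff)
  have AJ: "A ** J = 0"
  proof -
    have "(\<Sum>j\<in>UNIV. A $ i $ j) = 0" for i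
      using kron_id_lap_mat[of p L "(\<chi> i. 1) :: real^'b" i] by (simp add: kron_id_def A_def)
    then show ?thesis
      by (simp add: J_def matrix_matrix_mult_def vec_eq_iff sum_divide_distrib[symmetric])
  qed
  have "u = 0" if "(A + J) *v u = 0" for u
  proof -
    have JA: "J ** A = 0"
    proof -
      have "J ** A = transpose (A ** J)"
        using tJ by (simp add: matrix_transpose_mul A_def lap_mat_symmetric)
      then show ?thesis using AJ by (simp add: transpose_def vec_eq_iff)
    qed
    \<comment> \<open>Multiplying by \<open>J\<close> separates the two summands:
      \<open>J *v u\<close> and then \<open>A *v u\<close> vanish, so \<open>u\<close> is constant
      and equal to its own average, which is 0.\<close>
    have "J *v u = (J ** (A + J)) *v u" by (simp add: matrix_add_ldistrib JA JJ)
    also have "\<dots> = 0" using that by (simp flip: matrix_vector_mul_assoc)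
    finally have Ju: "J *v u = 0" .
    then have "A *v u = 0" using that by (simp add: matrix_vector_mult_add_rdistrib)
    then have c: "u $ i = u $ j" for i j
      using lap_mat_kernel[OF assms(1-4)] by (auto simp: A_def)
    have "u $ i = (J *v u) $ i" for i
    proof -
      have "u = (\<chi> j. u $ i)" using c[of _ i] by (simp add: vec_eq_iff)
      moreover have "(J *v (\<chi> j. t)) $ i = t" for t
        by (simp add: matrix_vector_mult_def J_def)
      ultimately show ?thesis by metis
    qed
    then show ?thesis using Ju by (simp add: vec_eq_iff)
  qed
  then have "invertible (A + J)"
    by (simp add: invertible_left_inverse matrix_left_invertible_ker)
  then have "A ** pinv A = mat 1 - J"
    using mul_pinv_of_kernel_projection[of A J] tJ JJ AJ by (simp add: A_def lap_mat_symmetric)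
  then have "kron_id A (kron_id (pinv A) v) = kron_id (mat 1 - J) v"
    by (simp flip: kron_id_mult)
  also have "\<dots> = v"
  proof -
    have "(\<Sum>j\<in>UNIV. (mat 1 - J) $ i $ j *\<^sub>R v $ j) = v $ i" for i
    proof -
      have "(\<Sum>j\<in>UNIV. (mat 1 - J) $ i $ j *\<^sub>R v $ j)
          = (\<Sum>j\<in>UNIV. (if j = i then v $ j else 0) - (1 / real CARD('b)) *\<^sub>R v $ j)"
        by (rule sum.cong) (auto simp: J_def mat_def algebra_simps)
      then show ?thesis by (simp add: sum_subtractf v flip: scaleR_sum_right)
    qed
    then show ?thesis by (simp add: kron_id_def vec_eq_iff)
  qed
  finally show ?thesis by (simp add: A_def)
qed

lemma kron_id_deg_mat: "kron_id (deg_mat p L) v $ i = ((\<Sum>r\<in>UNIV - {i}. p {i, r}) / L) *\<^sub>R v $ i"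
proof -
  have "(\<Sum>j\<in>UNIV. (deg_mat p L $ i $ j) *\<^sub>R v $ j)
      = (\<Sum>j\<in>UNIV. if j = i then ((\<Sum>r\<in>UNIV - {i}. p {i, r}) / L) *\<^sub>R v $ j else 0)"
    by (rule sum.cong) (auto simp: deg_mat_def)
  then show ?thesis by (simp add: kron_id_def)
qed

lemma kron_id_deg_mat_inv:
  fixes v :: "('a::real_vector)^'b::finite"
  assumes "L > 0" "\<And>i. (\<Sum>r\<in>UNIV - {i}. p {i, r}) > 0"
  shows "kron_id (deg_mat p L) (kron_id (matrix_inv (deg_mat p L)) v) = v"
proof -
  let ?q = "\<lambda>i. (\<Sum>r\<in>UNIV - {i}. p {i, r}) / L"
  have q: "?q i \<noteq> 0" for i using assms less_imp_neq[OF assms(2)[of i]] by simp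
  have "u = 0" if "deg_mat p L *v u = 0" for u
  proof -
    have "?q i * u $ i = 0" for i
      using that by (simp add: matrix_vector_mult_eq_kron_id vec_eq_iff kron_id_deg_mat)
    then show ?thesis using q by (simp add: vec_eq_iff del: divide_eq_0_iff times_divide_eq_left)
  qed
  then have "invertible (deg_mat p L)"
    by (simp add: invertible_left_inverse matrix_left_invertible_ker)
  then have "deg_mat p L ** matrix_inv (deg_mat p L) = mat 1" by (rule invertible_matrix_inv)
  then have "kron_id (deg_mat p L) (kron_id (matrix_inv (deg_mat p L)) v) = kron_id (mat 1) v"
    by (simp flip: kron_id_mult)
  also have "\<dots> = v"
    by (simp add: kron_id_def mat_def vec_eq_iff if_distrib[of "\<lambda>t. t *\<^sub>R _"] cong: if_cong)
  finally show ?thesis .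
qed


section \<open>Projection onto the directions of an edge, and the dual norm\<close>

definition pair_proj ::
  "'b set \<Rightarrow> ('y::finite, 'z::finite, 'b::finite) point \<Rightarrow> ('y, 'z, 'b) point" where
  "pair_proj e g = (\<chi> r. if r \<in> e
     then (fst (g $ r) - (1 / real (card e)) *\<^sub>R (\<Sum>s\<in>e. fst (g $ s)), snd (g $ r)) else 0)"

lemma pair_proj_mem: "pair_proj e g \<in> pair_dirs e"
proof -
  have "(\<Sum>r\<in>e. fst (pair_proj e g $ r)) 
    = (\<Sum>r\<in>e. fst (g $ r) - (1 / real (card e)) *\<^sub>R (\<Sum>s\<in>e. fst (g $ s)))"
    by (intro sum.cong refl) (simp add: pair_proj_def)
  also have "\<dots> = 0"
    by (cases "e = {}") (simp_all add: sum_subtractf sum_constant_scaleR del: sum_constant)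
  finally show ?thesis by (simp add: pair_dirs_def) (simp add: pair_proj_def)
qed

lemma linear_pair_proj: "linear (pair_proj e)"
proof (rule linearI)
  show "pair_proj e (g + h) = pair_proj e g + pair_proj e h" for g h
    by (simp add: pair_proj_def vec_eq_iff prod_eq_iff sum.distrib algebra_simps)
  show "pair_proj e (c *\<^sub>R g) = c *\<^sub>R pair_proj e g" for c g
    by (simp add: pair_proj_def vec_eq_iff prod_eq_iff algebra_simps flip: scaleR_sum_right)
qed

lemma subspace_pair_dirs: "subspace (pair_dirs e)"
  by (auto simp: subspace_def pair_dirs_def sum.distrib simp flip: scaleR_sum_right)

lemma pair_dirs_scaleR: "d \<in> pair_dirs e \<Longrightarrow> c *\<^sub>R d \<in> pair_dirs e"
  by (simp add: subspace_pair_dirs subspace_scale)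

text \<open>On \<open>e\<close> the difference of \<open>g\<close> and its projection has the same
  y-part \<open>?m\<close> in every block and zero z-part; the y-parts of \<open>d\<close> sum to
  zero over \<open>e\<close> and \<open>d\<close> vanishes elsewhere. With
  \<open>pair_proj_mem\<close> this makes \<open>pair_proj e\<close> the orthogonal
  projection.\<close>

lemma inner_pair_proj:
  assumes "d \<in> pair_dirs e"
  shows "pair_proj e g \<bullet> d = g \<bullet> d"
proof -
  let ?m = "(1 / real (card e)) *\<^sub>R (\<Sum>s\<in>e. fst (g $ s))"
  have "g \<bullet> d - pair_proj e g \<bullet> d = (\<Sum>r\<in>UNIV. (g $ r - pair_proj e g $ r) \<bullet> d $ r)"
    by (simp add: inner_vec_def sum_subtractf inner_diff_left)
  also have "\<dots> = (\<Sum>r\<in>e. ?m \<bullet> fst (d $ r))"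
    by (rule sum.mono_neutral_cong_right)
       (use assms in \<open>auto simp: pair_dirs_def pair_proj_def inner_prod_def\<close>)
  also have "\<dots> = ?m \<bullet> (\<Sum>r\<in>e. fst (d $ r))" by (rule inner_sum_right[symmetric])
  also have "\<dots> = 0" using assms by (simp add: pair_dirs_def)
  finally show ?thesis by simp
qed

lemma pair_proj_self_adjoint: "pair_proj e g \<bullet> h = pair_proj e g \<bullet> pair_proj e h"
  by (metis inner_pair_proj inner_commute pair_proj_mem)

lemma inner_pair_proj_self: "g \<bullet> pair_proj e g = (norm (pair_proj e g))\<^sup>2"
  by (metis inner_commute pair_proj_self_adjoint power2_norm_eq_inner)

lemma norm_pair_proj_le: "norm (pair_proj e g) \<le> norm g"
proof -
  have "(norm (pair_proj e g))\<^sup>2 \<le> norm g * norm (pair_proj e g)"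
    by (metis inner_pair_proj_self norm_cauchy_schwarz)
  then show ?thesis
    by (cases "pair_proj e g = 0") (simp_all add: power2_eq_square)
qed

text \<open>Completing the square: on \<open>pair_dirs e\<close> the objective is, up to a constant,
  a positive multiple of the squared distance to \<open>- q\<close>, which itself lies in
  \<open>pair_dirs e\<close>.\<close>

lemma is_pair_step_eq:
  assumes "L > 0" "a \<ge> 0" "is_pair_step L a g e x d"
  shows "d = - (a / L) *\<^sub>R pair_proj e (grad g x)"
proof (cases "a = 0")
  case False
  define q where "q = (a / L) *\<^sub>R pair_proj e (grad g x)"
  have a: "a > 0" using False assms by simp
  have obj: "grad g x \<bullet> d + L / (2 * a) * (norm d)\<^sup>2
      = L / (2 * a) * ((norm (d + q))\<^sup>2 - (norm q)\<^sup>2)" if "d \<in> pair_dirs e" for d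
  proof -
    have "grad g x \<bullet> d = (L / a) * (q \<bullet> d)"
      using a assms(1) inner_pair_proj[OF that, of "grad g x"] by (simp add: q_def)
    moreover have "(norm (d + q))\<^sup>2 = (norm d)\<^sup>2 + (norm q)\<^sup>2 + 2 * (q \<bullet> d)"
      by (simp add: power2_norm_eq_inner algebra_simps inner_commute)
    ultimately show ?thesis using a assms(1) by (simp add: field_simps)
  qed
  have d: "d \<in> pair_dirs e" using assms(3) False by (simp add: is_pair_step_def is_arg_min_def)
  have mq: "- q \<in> pair_dirs e"
    unfolding q_def using pair_dirs_scaleR[OF pair_proj_mem, of "- (a / L)"] by simp
  have "\<not> L / (2 * a) * ((norm (- q + q))\<^sup>2 - (norm q)\<^sup>2) < L / (2 * a) * ((norm (d + q))\<^sup>2 - (norm q)\<^sup>2)"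
    using assms(3) False mq obj[OF mq] obj[OF d] by (auto simp: is_pair_step_def is_arg_min_def)
  then have "(norm (d + q))\<^sup>2 \<le> 0"
    using a assms(1) by (simp add: not_less right_diff_distrib diff_divide_distrib divide_le_0_iff
        mult_le_0_iff)
  then have "d + q = 0" by simp
  then show ?thesis by (simp add: q_def eq_neg_iff_add_eq_0)
qed (use assms in \<open>simp add: is_pair_step_def\<close>)

lemma sum_edges_at:
  fixes h :: "'b::finite set \<Rightarrow> 'a::real_vector"
  assumes "\<And>e. e \<in> E \<Longrightarrow> card e = 2" "\<And>e. e \<notin> E \<Longrightarrow> p e = 0"
  shows "(\<Sum>e\<in>E. if r \<in> e then p e *\<^sub>R h e else 0) = (\<Sum>s\<in>UNIV - {r}. p {r, s} *\<^sub>R h {r, s})"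
proof -
  have "(\<Sum>e\<in>E. if r \<in> e then p e *\<^sub>R h e else 0) = (\<Sum>e\<in>{e. card e = 2 \<and> r \<in> e}. p e *\<^sub>R h e)"
    using assms by (intro sum.mono_neutral_cong) auto
  also have "\<dots> = (\<Sum>s\<in>UNIV - {r}. p {r, s} *\<^sub>R h {r, s})"
  proof (rule sum.reindex_cong[of "\<lambda>s. {r, s}"])
    show "inj_on (\<lambda>s. {r, s}) (UNIV - {r})" by (auto simp: inj_on_def doubleton_eq_iff)
    show "{e. card e = 2 \<and> r \<in> e} = (\<lambda>s. {r, s}) ` (UNIV - {r})"
      by (auto simp: card_2_iff)
  qed simp
  finally show ?thesis .
qed

text \<open>Subtracting the mean of two blocks leaves half their difference; this half is the 2 in
  the denominators of \<open>lap_mat\<close>, absent from \<open>deg_mat\<close> because z-parts are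
  not centred.\<close>

lemma sum_pair_proj_nth:
  assumes "\<And>e. e \<in> E \<Longrightarrow> card e = 2" "\<And>e. e \<notin> E \<Longrightarrow> p e = 0" and L: "L > 0"
  shows "((\<Sum>e\<in>E. p e *\<^sub>R pair_proj e g) $ r) = L *\<^sub>R
     (kron_id (lap_mat p L) (\<chi> i. fst (g $ i)) $ r, kron_id (deg_mat p L) (\<chi> i. snd (g $ i)) $ r)"
proof -
  have "((\<Sum>e\<in>E. p e *\<^sub>R pair_proj e g) $ r) = (\<Sum>e\<in>E. if r \<in> e then p e *\<^sub>R
      (fst (g $ r) - (1 / real (card e)) *\<^sub>R (\<Sum>s\<in>e. fst (g $ s)), snd (g $ r)) else 0)"
    by (simp add: sum_component pair_proj_def) (rule sum.cong; simp)
  also have "\<dots> = (\<Sum>s\<in>UNIV - {r}. p {r, s} *\<^sub>R (fst (g $ r)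
      - (1 / real (card {r, s})) *\<^sub>R (\<Sum>s\<in>{r, s}. fst (g $ s)), snd (g $ r)))"
    by (rule sum_edges_at[OF assms(1,2)])
  also have "\<dots> = (\<Sum>s\<in>UNIV - {r}. ((p {r, s} / 2) *\<^sub>R (fst (g $ r) - fst (g $ s)), p {r, s} *\<^sub>R snd (g $ r)))"
  proof (rule sum.cong[OF refl])
    fix s assume "s \<in> UNIV - {r}"
    then have "fst (g $ r) - (1 / real (card {r, s})) *\<^sub>R (\<Sum>s\<in>{r, s}. fst (g $ s))
       = (1 / 2) *\<^sub>R (fst (g $ r) - fst (g $ s))"
      by (simp add: vec_eq_iff field_simps)
    then show "p {r, s} *\<^sub>R (fst (g $ r)
      - (1 / real (card {r, s})) *\<^sub>R (\<Sum>s\<in>{r, s}. fst (g $ s)), snd (g $ r))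
      = ((p {r, s} / 2) *\<^sub>R (fst (g $ r) - fst (g $ s)), p {r, s} *\<^sub>R snd (g $ r))"
      by simp
  qed
  also have "\<dots> = L *\<^sub>R
     (kron_id (lap_mat p L) (\<chi> i. fst (g $ i)) $ r, kron_id (deg_mat p L) (\<chi> i. snd (g $ i)) $ r)"
    using L by (simp add: kron_id_lap_mat kron_id_deg_mat prod_eq_iff fst_sum snd_sum scaleR_sum_right
      scaleR_sum_left)
  finally show ?thesis .
qed

text \<open>An edge provides a vertex other than \<open>i\<close>, and the first step of a path from
  \<open>i\<close> to it is an edge at \<open>i\<close>. This makes the degree matrix
  invertible.\<close>

lemma sum_incident_pos:
  fixes p :: "'b::finite set \<Rightarrow> real"
  assumes "connected_graph E" "\<And>e. e \<in> E \<Longrightarrow> p e > 0" "\<And>e. e \<notin> E \<Longrightarrow> p e = 0" "E \<noteq> {}"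
  shows "(\<Sum>r\<in>UNIV - {i}. p {i, r}) > 0"
proof -
  obtain e where e: "e \<in> E" "card e = 2" using assms(1,4) by (auto simp: connected_graph_def)
  then obtain j where j: "j \<noteq> i" by (metis card_2_iff)
  have "(i, j) \<in> {(u, v). {u, v} \<in> E}\<^sup>*" using assms(1) by (simp add: connected_graph_def)
  then obtain r where r: "{i, r} \<in> E" using j by (cases rule: converse_rtranclE) auto
  then have "r \<noteq> i" using assms(1) by (auto simp: connected_graph_def)
  moreover have "p e \<ge> 0" for e using assms(2,3)[of e] by (cases "e \<in> E") auto
  ultimately show ?thesis
    using assms(2)[OF r] by (intro sum_pos2[of _ r]) auto
qed

lemma weighted_inner_cauchy_schwarz:
  fixes u v :: "'e \<Rightarrow> 'a::real_inner"
  assumes "finite E" "\<And>e. e \<in> E \<Longrightarrow> p e \<ge> 0"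
  shows "(\<Sum>e\<in>E. p e * (u e \<bullet> v e))
    \<le> sqrt (\<Sum>e\<in>E. p e * (norm (u e))\<^sup>2) * sqrt (\<Sum>e\<in>E. p e * (norm (v e))\<^sup>2)"
proof -
  have "(\<Sum>e\<in>E. p e * (u e \<bullet> v e)) \<le> (\<Sum>e\<in>E. (sqrt (p e) * norm (u e)) * (sqrt (p e) * norm (v e)))"
  proof (rule sum_mono)
    fix e assume e: "e \<in> E"
    have "p e * (u e \<bullet> v e) \<le> p e * (norm (u e) * norm (v e))"
      using assms(2)[OF e] by (intro mult_left_mono norm_cauchy_schwarz)
    also have "\<dots> = (sqrt (p e) * norm (u e)) * (sqrt (p e) * norm (v e))"
      using assms(2)[OF e] by (simp add: algebra_simps flip: power2_eq_square)
    finally show "p e * (u e \<bullet> v e) \<le> (sqrt (p e) * norm (u e)) * (sqrt (p e) * norm (v e))" .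
  qed
  also have "\<dots> \<le> L2_set (\<lambda>e. sqrt (p e) * norm (u e)) E * L2_set (\<lambda>e. sqrt (p e) * norm (v e)) E"
    using L2_set_mult_ineq[of "\<lambda>e. sqrt (p e) * norm (u e)" "\<lambda>e. sqrt (p e) * norm (v e)" E]
      assms(2) by (simp cong: sum.cong)
  finally show ?thesis using assms(2) by (simp add: L2_set_def power_mult_distrib)
qed

lemma inner_le_K_dual_norm:
  fixes g v :: "('y::finite, 'z::finite, 'b::finite) point"
  assumes L: "L > 0" and G: "connected_graph E" and p: "\<And>e. e \<in> E \<Longrightarrow> p e > 0"
    "\<And>e. e \<notin> E \<Longrightarrow> p e = 0" and ne: "E \<noteq> {}" and v: "v \<in> feasible"
  shows "g \<bullet> v \<le> sqrt ((\<Sum>e\<in>E. p e * (norm (pair_proj e g))\<^sup>2) / L) * K_dual_norm p L v"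
proof -
  define A where "A = lap_mat p L"
  define D where "D = deg_mat p L"
  define y where "y = (\<chi> i. fst (v $ i))"
  define z where "z = (\<chi> i. snd (v $ i))"
  \<comment> \<open>A preimage of \<open>v\<close> under the operator (1/L) sum_e p_e P_e.
    Feasibility of \<open>v\<close> is what puts its y-part in the range of the Laplacian.\<close>
  define W :: "('y, 'z, 'b) point"
    where "W = (\<chi> i. (kron_id (pinv A) y $ i, kron_id (matrix_inv D) z $ i))"
  have c: "\<And>e. e \<in> E \<Longrightarrow> card e = 2" using G by (simp add: connected_graph_def)
  have yA: "kron_id A (kron_id (pinv A) y) = y"
    unfolding A_def using v by (intro kron_id_lap_mat_pinv[OF L G p]) (auto simp: y_def feasible_def)
  have zD: "kron_id D (kron_id (matrix_inv D) z) = z"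
    unfolding D_def by (intro kron_id_deg_mat_inv[OF L] sum_incident_pos[OF G p ne])
  have TW: "(\<Sum>e\<in>E. p e *\<^sub>R pair_proj e W) = L *\<^sub>R v"
  proof -
    have "(\<chi> i. fst (W $ i)) = kron_id (pinv A) y" "(\<chi> i. snd (W $ i)) = kron_id (matrix_inv D) z"
      by (simp_all add: W_def vec_eq_iff)
    then have "(\<Sum>e\<in>E. p e *\<^sub>R pair_proj e W) $ r = L *\<^sub>R (y $ r, z $ r)" for r
      using yA zD sum_pair_proj_nth[where p = p and r = r and g = W, OF c p(2) L]
      by (simp add: A_def D_def)
    then show ?thesis by (simp add: vec_eq_iff y_def z_def)
  qed
  \<comment> \<open>Used twice: \<open>h = g\<close> expresses the inner product to be bounded,
    \<open>h = W\<close> identifies the second Cauchy-Schwarz factor with the dual norm of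
    \<open>v\<close>.\<close>
  have inner_T: "L * (h \<bullet> v) = (\<Sum>e\<in>E. p e * (pair_proj e h \<bullet> pair_proj e W))" for h
  proof -
    have "L * (h \<bullet> v) = h \<bullet> (\<Sum>e\<in>E. p e *\<^sub>R pair_proj e W)" by (simp add: TW)
    also have "\<dots> = (\<Sum>e\<in>E. p e * (pair_proj e h \<bullet> pair_proj e W))"
      by (simp add: inner_sum_right) (metis inner_commute pair_proj_self_adjoint)
    finally show ?thesis .
  qed
  have "W \<bullet> v = y \<bullet> kron_id (pinv A) y + z \<bullet> kron_id (matrix_inv D) z"
    by (simp add: W_def y_def z_def inner_vec_def inner_prod_def sum.distrib mult.commute)
  then have K: "K_dual_norm p L v = sqrt ((\<Sum>e\<in>E. p e * (norm (pair_proj e W))\<^sup>2) / L)"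
    using inner_T[of W] L
    by (simp add: K_dual_norm_def Let_def A_def D_def y_def z_def power2_norm_eq_inner field_simps)
  have "L * (g \<bullet> v) \<le> sqrt (\<Sum>e\<in>E. p e * (norm (pair_proj e g))\<^sup>2)
      * sqrt (\<Sum>e\<in>E. p e * (norm (pair_proj e W))\<^sup>2)"
    unfolding inner_T using p(1) by (intro weighted_inner_cauchy_schwarz) (auto intro: less_imp_le)
  also have "\<dots> = L * (sqrt ((\<Sum>e\<in>E. p e * (norm (pair_proj e g))\<^sup>2) / L) * K_dual_norm p L v)"
    using L by (simp add: K real_sqrt_divide field_simps flip: power2_eq_square)
  finally show ?thesis using L by (simp add: mult_le_cancel_left_pos)
qed


section \<open>Gradients, smoothness and convexity\<close>

lemma grad_eqI:
  assumes "GDERIV f x :> D"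
  shows "grad f x = D"
  unfolding grad_def
proof (rule the_equality)
  fix D' assume "GDERIV f x :> D'"
  then have "(\<lambda>h. h \<bullet> D') = (\<lambda>h. h \<bullet> D)"
    using assms unfolding gderiv_def by (rule has_derivative_unique)
  then have "(D' - D) \<bullet> (D' - D) = 0" by (simp add: inner_diff_right fun_eq_iff)
  then show "D' = D" by simp
qed (rule assms)

lemma differentiable_imp_GDERIV_grad:
  fixes f :: "'a::euclidean_space \<Rightarrow> real"
  assumes "f differentiable (at x)"
  shows "GDERIV f x :> grad f x"
proof -
  obtain f' where f': "(f has_derivative f') (at x)" using assms by (auto simp: differentiable_def)
  define D where "D = (\<Sum>i\<in>Basis. f' i *\<^sub>R i)"
  have "f' h = h \<bullet> D" for h
  proof -
    have "f' h = f' (\<Sum>i\<in>Basis. (h \<bullet> i) *\<^sub>R i)" by (simp add: euclidean_representation)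
    also have "\<dots> = (\<Sum>i\<in>Basis. (h \<bullet> i) * f' i)"
      using has_derivative_linear[OF f'] by (simp add: linear_sum linear_cmul)
    finally show ?thesis by (simp add: D_def inner_sum_right mult.commute)
  qed
  then have "f' = (\<lambda>h. h \<bullet> D)" by (rule ext)
  then have "GDERIV f x :> D" using f' by (simp add: gderiv_def)
  then show ?thesis using grad_eqI by metis
qed

lemma grad_average:
  fixes F :: "nat \<Rightarrow> 'a::euclidean_space \<Rightarrow> real"
  assumes "\<And>x. f x = c * (\<Sum>l\<in>I. F l x)" "finite I" "\<And>l. l \<in> I \<Longrightarrow> F l differentiable (at x)"
  shows "grad f x = c *\<^sub>R (\<Sum>l\<in>I. grad (F l) x)"
proof (rule grad_eqI)
  have "((\<lambda>x. c * (\<Sum>l\<in>I. F l x)) has_derivative (\<lambda>h. c * (\<Sum>l\<in>I. h \<bullet> grad (F l) x))) (at x)"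
    using assms(3) differentiable_imp_GDERIV_grad
    by (intro has_derivative_mult_right has_derivative_sum) (auto simp: gderiv_def)
  moreover have "f = (\<lambda>x. c * (\<Sum>l\<in>I. F l x))" using assms(1) by (rule ext)
  ultimately show "GDERIV f x :> c *\<^sub>R (\<Sum>l\<in>I. grad (F l) x)"
    by (simp add: gderiv_def inner_sum_right)
qed

lemma GDERIV_along_line:
  fixes f :: "'a::euclidean_space \<Rightarrow> real"
  assumes "f differentiable (at (x + t *\<^sub>R d))"
  shows "((\<lambda>t. f (x + t *\<^sub>R d)) has_real_derivative grad f (x + t *\<^sub>R d) \<bullet> d) (at t)"
proof -
  have f: "(f has_derivative (\<lambda>h. h \<bullet> grad f (x + t *\<^sub>R d))) (at (x + t *\<^sub>R d))"
    using differentiable_imp_GDERIV_grad[OF assms] by (simp add: gderiv_def)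
  have "((\<lambda>t. x + t *\<^sub>R d) has_derivative (\<lambda>s. s *\<^sub>R d)) (at t)"
    by (auto intro!: derivative_eq_intros)
  from has_derivative_compose[OF this f] show ?thesis
    unfolding has_field_derivative_def
    by (rule has_derivative_eq_rhs) (simp add: fun_eq_iff inner_commute)
qed

text \<open>The gradient bound is asked for only along \<open>d\<close>, since the problem controls
  only partial gradients on pairs of blocks. The difference \<open>?\<psi>\<close> of the two sides
  along the segment has nonpositive derivative.\<close>

lemma descent_lemma:
  fixes f :: "'a::euclidean_space \<Rightarrow> real"
  assumes diff: "\<And>x. f differentiable (at x)"
    and lip: "\<And>t. 0 \<le> t \<Longrightarrow> (grad f (x + t *\<^sub>R d) - grad f x) \<bullet> d \<le> L * t * (norm d)\<^sup>2"
  shows "f (x + d) \<le> f x + grad f x \<bullet> d + L / 2 * (norm d)\<^sup>2"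
proof -
  let ?\<psi> = "\<lambda>t. f (x + t *\<^sub>R d) - t * (grad f x \<bullet> d) - L / 2 * t\<^sup>2 * (norm d)\<^sup>2"
  have "?\<psi> 1 \<le> ?\<psi> 0"
  proof (rule DERIV_nonpos_imp_nonincreasing[where f = ?\<psi> and a = 0 and b = 1])
    fix t :: real assume "0 \<le> t"
    have "(?\<psi> has_real_derivative (grad f (x + t *\<^sub>R d) \<bullet> d - grad f x \<bullet> d - L * t * (norm d)\<^sup>2)) (at t)"
      by (auto intro!: derivative_eq_intros GDERIV_along_line diff)
    then show "\<exists>y. (?\<psi> has_real_derivative y) (at t) \<and> y \<le> 0"
      using lip[OF \<open>0 \<le> t\<close>] by (auto simp: inner_diff_left)
  qed simp
  then show ?thesis by simp
qed

lemma grad_convex_lower_bound: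
  fixes f :: "'a::euclidean_space \<Rightarrow> real"
  assumes "convex_on UNIV f" "\<And>x. f differentiable (at x)"
  shows "f y \<ge> f x + grad f x \<bullet> (y - x)"
proof -
  let ?\<phi> = "\<lambda>t. f (x + t *\<^sub>R (y - x))"
  have "convex_on UNIV ?\<phi>"
  proof (rule convex_onI)
    fix t a b :: real assume t: "0 < t" "t < 1"
    have "x + ((1 - t) *\<^sub>R a + t *\<^sub>R b) *\<^sub>R (y - x)
        = (1 - t) *\<^sub>R (x + a *\<^sub>R (y - x)) + t *\<^sub>R (x + b *\<^sub>R (y - x))"
      by (simp add: algebra_simps)
    then show "?\<phi> ((1 - t) *\<^sub>R a + t *\<^sub>R b) \<le> (1 - t) * ?\<phi> a + t * ?\<phi> b"
      using convex_onD[OF assms(1), of t "x + a *\<^sub>R (y - x)" "x + b *\<^sub>R (y - x)"] t by simp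
  qed simp
  then have "(grad f (x + 0 *\<^sub>R (y - x)) \<bullet> (y - x)) * (1 - 0) \<le> ?\<phi> 1 - ?\<phi> 0"
    by (rule convex_on_imp_above_tangent) (use GDERIV_along_line[OF assms(2), of x "y - x" 0] in auto)
  then show ?thesis by simp
qed

lemma norm_grad_bound_imp_lipschitz:
  fixes f :: "'a::euclidean_space \<Rightarrow> real"
  assumes "\<And>x. f differentiable (at x)" "\<And>x. norm (grad f x) \<le> M"
  shows "\<bar>f (x + d) - f x\<bar> \<le> M * norm d"
proof -
  obtain t where t: "f (x + 1 *\<^sub>R d) - f (x + 0 *\<^sub>R d) = (1 - 0) * (grad f (x + t *\<^sub>R d) \<bullet> d)"
    using MVT2[of 0 1 "\<lambda>t. f (x + t *\<^sub>R d)" "\<lambda>t. grad f (x + t *\<^sub>R d) \<bullet> d"] GDERIV_along_line[OF assms(1)]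
    by auto
  then have "\<bar>f (x + d) - f x\<bar> = \<bar>grad f (x + t *\<^sub>R d) \<bullet> d\<bar>" by simp
  also have "\<dots> \<le> norm (grad f (x + t *\<^sub>R d)) * norm d" by (rule Cauchy_Schwarz_ineq2)
  also have "\<dots> \<le> M * norm d" by (intro mult_right_mono assms) simp
  finally show ?thesis .
qed


section \<open>Recursions with steps of order 1/sqrt n\<close>

lemma sqrt_Suc_step: "1 / sqrt (real n + 1) \<le> 2 * (sqrt (real n + 1) - sqrt (real n))"
proof -
  have p: "sqrt (real n + 1) > 0" by simp
  have "2 * (sqrt (real n + 1) - sqrt (real n)) * sqrt (real n + 1) - 1
      = (sqrt (real n + 1) - sqrt (real n))\<^sup>2"
    by (simp add: power2_eq_square algebra_simps)
  then have "1 \<le> 2 * (sqrt (real n + 1) - sqrt (real n)) * sqrt (real n + 1)"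
    by (metis diff_ge_0_iff_ge zero_le_power2)
  then show ?thesis using p by (simp add: pos_divide_le_eq)
qed

lemma sum_inverse_sqrt_le: "(\<Sum>i<n. 1 / sqrt (real i + 1)) \<le> 2 * sqrt (real n)"
proof (induction n)
  case (Suc n)
  then show ?case using sqrt_Suc_step[of n] by (simp add: add.commute)
qed simp

lemma telescoped_sum_le_sqrt:
  fixes Q S :: "nat \<Rightarrow> real"
  assumes step: "\<And>n. Q (Suc n) \<le> Q n - S n + K / sqrt (real n + 1)"
    and nonneg: "\<And>n. Q n \<ge> 0" "K \<ge> 0"
  shows "(\<Sum>i<n. S i) \<le> (Q 0 + 2 * K) * sqrt (real n)"
proof -
  have "(\<Sum>i<n. S i) \<le> Q 0 - Q n + K * (\<Sum>i<n. 1 / sqrt (real i + 1))" for n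
  proof (induction n)
    case (Suc n)
    then show ?case using step[of n] by (simp add: algebra_simps)
  qed simp
  from this[of n] have "(\<Sum>i<n. S i) \<le> Q 0 + K * (2 * sqrt (real n))"
    using nonneg(1)[of n] mult_left_mono[OF sum_inverse_sqrt_le nonneg(2), of n] by linarith
  \<comment> \<open>For \<open>n > 0\<close> the initial value is absorbed into the multiple of sqrt
    n; for \<open>n = 0\<close> the sum is empty.\<close>
  moreover have "Q 0 * 1 \<le> Q 0 * sqrt (real n)" if "n > 0"
    using that nonneg(1)[of 0] by (intro mult_left_mono) auto
  ultimately show ?thesis by (cases "n = 0") (simp_all add: algebra_simps)
qed

text \<open>Summing the first recursion directly would produce the divergent sum of the squared step
  sizes, hence a logarithm. Dividing it by the step size first leaves, after summation by parts,
  the weighted sum of \<open>A\<close>, which the second recursion controls.\<close>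

lemma sum_le_sqrt_of_two_recursions:
  fixes A V Q :: "nat \<Rightarrow> real"
  assumes pos: "\<kappa> > 0" "c > 0" "d > 0" "C \<ge> 0" "K \<ge> 0"
    and nonneg: "\<And>n. A n \<ge> 0" "\<And>n. Q n \<ge> 0"
    and A: "\<And>n. A (Suc n) \<le> A n - c * (\<kappa> / sqrt (real n + 1)) * V n + C * (\<kappa> / sqrt (real n + 1))\<^sup>2"
    and Q: "\<And>n. Q (Suc n) \<le> Q n - d * (\<kappa> / sqrt (real n + 1)) * A n + K * (\<kappa> / sqrt (real n + 1))"
  shows "\<exists>C'\<ge>0. \<forall>n. (\<Sum>i<n. V i) \<le> C' * sqrt (real n)"
proof -
  define s where "s n = sqrt (real n + 1)" for n
  have s: "s n > 0" "s n * s n = real n + 1" for n by (simp_all add: s_def)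
  have 1: "(\<Sum>i<n. d * (\<kappa> / s i) * A i) \<le> (Q 0 + 2 * (K * \<kappa>)) * sqrt (real n)" for n
    using Q nonneg(2) pos by (intro telescoped_sum_le_sqrt) (simp_all add: s_def)
  \<comment> \<open>The first recursion multiplied by \<open>s n / \<kappa>\<close>. The telescoping
    quantity \<open>sqrt (real n) * A n / \<kappa>\<close> starts at 0, hence the 0 in the
    constant.\<close>
  have 2: "(\<Sum>i<n. c * V i - A i / (\<kappa> * s i)) \<le> (0 + 2 * (C * \<kappa>)) * sqrt (real n)" for n
  proof -
    have "sqrt (real (Suc n)) * A (Suc n) / \<kappa>
      \<le> sqrt (real n) * A n / \<kappa> - (c * V n - A n / (\<kappa> * s n)) + C * \<kappa> / sqrt (real n + 1)" for n
    proof -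
      have "s n * A (Suc n) / \<kappa> \<le> s n * (A n - c * (\<kappa> / s n) * V n + C * (\<kappa> / s n)\<^sup>2) / \<kappa>"
        using A[of n] s(1)[of n] pos by (intro divide_right_mono mult_left_mono) (auto simp: s_def)
      also have "\<dots> = s n * A n / \<kappa> - c * V n + C * \<kappa> / s n"
        using s(1)[of n] pos by (simp add: field_simps power2_eq_square)
      \<comment> \<open>The weight grows from sqrt n to sqrt (n + 1), by at most
        \<open>1 / s n\<close>; this is the source of the correction
        \<open>A n / (\<kappa> * s n)\<close>.\<close>
      also have "s n * A n / \<kappa> \<le> (sqrt (real n) + 1 / s n) * A n / \<kappa>"
      proof (intro divide_right_mono mult_right_mono nonneg)
        have "sqrt (real n) * sqrt (real n) \<le> sqrt (real n) * s n"
          by (intro mult_left_mono) (auto simp: s_def)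
        then have "s n * s n \<le> (sqrt (real n) + 1 / s n) * s n"
          using s[of n] by (simp add: algebra_simps)
        then show "s n \<le> sqrt (real n) + 1 / s n" using s(1)[of n] by simp
      qed (use pos in simp)
      finally show ?thesis
        using pos by (simp add: s_def add.commute mult.commute[of \<kappa>] distrib_right add_divide_distrib)
    qed
    from telescoped_sum_le_sqrt[where Q = "\<lambda>n. sqrt (real n) * A n / \<kappa>", OF this]
    show ?thesis using nonneg(1) pos by simp
  qed
  \<comment> \<open>Dividing bound 1 by \<open>d * \<kappa>\<^sup>2\<close> turns its summands into
    exactly the corrections subtracted in bound 2.\<close>
  define C' where "C' = (2 * (C * \<kappa>) + (Q 0 + 2 * (K * \<kappa>)) / (d * \<kappa>\<^sup>2)) / c"
  have "(\<Sum>i<n. V i) \<le> C' * sqrt (real n)" for n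
  proof -
    have "c * (\<Sum>i<n. V i) = (\<Sum>i<n. c * V i - A i / (\<kappa> * s i))
        + (\<Sum>i<n. d * (\<kappa> / s i) * A i) / (d * \<kappa>\<^sup>2)"
      using pos s(1) by (simp add: sum_distrib_left sum_divide_distrib sum_subtractf power2_eq_square mult_ac)
    also have "\<dots> \<le> (0 + 2 * (C * \<kappa>)) * sqrt (real n)
        + (Q 0 + 2 * (K * \<kappa>)) * sqrt (real n) / (d * \<kappa>\<^sup>2)"
      using pos by (intro add_mono 2 divide_right_mono 1) simp
    also have "\<dots> = c * (C' * sqrt (real n))"
      using pos by (simp add: C'_def field_simps)
    finally show ?thesis using pos by (simp add: mult_le_cancel_left_pos)
  qed
  moreover have "C' \<ge> 0" using pos nonneg(2)[of 0] by (simp add: C'_def)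
  ultimately show ?thesis by blast
qed


section \<open>One-step estimates\<close>

lemma descent_along_edge:
  fixes f :: "('y::finite, 'z::finite, 'b::finite) point \<Rightarrow> real"
  assumes diff: "\<And>x. f differentiable (at x)"
    and lip: "\<And>x h h'. norm (grad f (x + axis i h + axis j h') $ i - grad f x $ i,
               grad f (x + axis i h + axis j h') $ j - grad f x $ j) \<le> L * norm (h, h')"
    and "i \<noteq> j" and d: "d \<in> pair_dirs {i, j}"
  shows "f (x + d) \<le> f x + grad f x \<bullet> d + L / 2 * (norm d)\<^sup>2"
proof (rule descent_lemma[OF diff])
  fix t :: real assume t: "0 \<le> t"
  have off: "d $ r = 0" if "r \<noteq> i" "r \<noteq> j" for r using d that by (simp add: pair_dirs_def)
  have supp: "u \<bullet> d = u $ i \<bullet> d $ i + u $ j \<bullet> d $ j" for u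
  proof -
    have "u \<bullet> d = (\<Sum>r\<in>{i, j}. u $ r \<bullet> d $ r)"
      unfolding inner_vec_def by (rule sum.mono_neutral_right) (auto simp: off)
    then show ?thesis using \<open>i \<noteq> j\<close> by simp
  qed
  have nd: "norm (d $ i, d $ j) = norm d"
    by (simp add: norm_eq_sqrt_inner supp)
  have line: "x + t *\<^sub>R d = x + axis i (t *\<^sub>R d $ i) + axis j (t *\<^sub>R d $ j)"
  proof -
    have "t *\<^sub>R d = axis i (t *\<^sub>R d $ i) + axis j (t *\<^sub>R d $ j)"
      unfolding vec_eq_iff
    proof
      fix r show "(t *\<^sub>R d) $ r = (axis i (t *\<^sub>R d $ i) + axis j (t *\<^sub>R d $ j)) $ r"
        using off[of r] \<open>i \<noteq> j\<close> by (auto simp: axis_def)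
    qed
    then show ?thesis by (simp only: add.assoc)
  qed
  let ?u = "grad f (x + t *\<^sub>R d) - grad f x"
  have "?u \<bullet> d = (?u $ i, ?u $ j) \<bullet> (d $ i, d $ j)" by (simp add: supp)
  also have "\<dots> \<le> norm (?u $ i, ?u $ j) * norm (d $ i, d $ j)" by (rule norm_cauchy_schwarz)
  also have "\<dots> \<le> L * norm (t *\<^sub>R d $ i, t *\<^sub>R d $ j) * norm (d $ i, d $ j)"
    using lip[of x "t *\<^sub>R d $ i" "t *\<^sub>R d $ j"] unfolding line[symmetric]
    by (intro mult_right_mono) simp_all
  also have "norm (t *\<^sub>R d $ i, t *\<^sub>R d $ j) = t * norm d"
    using t norm_scaleR[of t "(d $ i, d $ j)"] by (simp add: nd)
  finally show "?u \<bullet> d \<le> L * t * (norm d)\<^sup>2" by (simp add: nd power2_eq_square mult_ac)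
qed

text \<open>The iterates may leave the level set of \<open>x0\<close>, the only place where the radius is bounded.
  Shrinking \<open>x\<close> towards the minimizer until it re-enters the level set still yields a bound,
  for the gap truncated at its initial value.\<close>

lemma truncated_gap_le:
  fixes f :: "('y::finite, 'z::finite, 'b::finite) point \<Rightarrow> real"
  assumes diff: "\<And>x. f differentiable (at x)" and convex: "convex_on UNIV f"
    and L: "L > 0" and G: "connected_graph E" and p: "\<And>e. e \<in> E \<Longrightarrow> p e > 0"
    "\<And>e. e \<notin> E \<Longrightarrow> p e = 0" and ne: "E \<noteq> {}"
    and x: "x \<in> feasible" and xs: "xs \<in> feasible"
    and min: "f xs \<le> f x" "f xs \<le> f x0"
    and R: "\<And>u. f u \<le> f x0 \<Longrightarrow> K_dual_norm p L (u - xs) \<le> R"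
  shows "min (f x - f xs) (f x0 - f xs) \<le> R * sqrt ((\<Sum>e\<in>E. p e * (norm (pair_proj e (grad f x)))\<^sup>2) / L)"
proof -
  let ?G = "sqrt ((\<Sum>e\<in>E. p e * (norm (pair_proj e (grad f x)))\<^sup>2) / L)"
  have G0: "?G \<ge> 0" using p(1)[THEN less_imp_le] L
    by (auto intro!: sum_nonneg divide_nonneg_nonneg mult_nonneg_nonneg)
  define a where "a = f x - f xs"
  define m where "m = min a (f x0 - f xs)"
  have am: "0 \<le> a" "0 \<le> m" "m \<le> a" "m \<le> f x0 - f xs" using min by (simp_all add: a_def m_def)
  \<comment> \<open>Chosen so that \<open>s * a = m\<close>: by convexity the gap at
    \<open>u\<close> is at most \<open>m\<close>, hence at most the initial gap. If
    \<open>a = 0\<close>, then \<open>m = 0\<close> as well.\<close>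
  define s where "s = (if a = 0 then 0 else m / a)"
  have s: "0 \<le> s" "s \<le> 1" "s * a = m" using am by (auto simp: s_def)
  define u where "u = xs + s *\<^sub>R (x - xs)"
  have "u = (1 - s) *\<^sub>R xs + s *\<^sub>R x" by (simp add: u_def algebra_simps)
  then have "f u \<le> (1 - s) * f xs + s * f x"
    using convex_onD[OF convex, of s xs x] s by simp
  also have "\<dots> = f xs + m" using s(3) by (simp add: a_def algebra_simps)
  finally have "f u \<le> f x0" using am by simp
  then have Ru: "K_dual_norm p L (u - xs) \<le> R" by (rule R)
  have uf: "u - xs \<in> feasible"
    using x xs by (simp add: u_def feasible_def sum_subtractf flip: scaleR_sum_right)
  \<comment> \<open>The tangent is taken at \<open>x\<close>, whose gradient occurs in the claim,
    not at \<open>u\<close>; scaling by \<open>s\<close> then turns \<open>x - xs\<close> into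
    \<open>u - xs\<close>.\<close>
  have "a \<le> grad f x \<bullet> (x - xs)"
    using grad_convex_lower_bound[OF convex diff, of x xs] by (simp add: a_def inner_diff_right)
  then have "s * a \<le> s * (grad f x \<bullet> (x - xs))" using s by (intro mult_left_mono)
  also have "\<dots> = grad f x \<bullet> (u - xs)" by (simp add: u_def)
  also have "\<dots> \<le> ?G * K_dual_norm p L (u - xs)"
    by (rule inner_le_K_dual_norm[OF L G p ne uf])
  also have "\<dots> \<le> ?G * R" using Ru G0 by (rule mult_left_mono)
  finally show ?thesis using s(3) by (simp add: m_def a_def mult.commute)
qed

text \<open>Smoothness is applied to \<open>f\<close> along the sampled step. The linear term is
  unbiased and averages to the squared projected gradients; the quadratic term is bounded through
  \<open>M\<close>, as projections do not lengthen.\<close>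

lemma expected_descent:
  fixes f :: "('y::finite, 'z::finite, 'b::finite) point \<Rightarrow> real"
  assumes N: "N \<ge> 1" and avg: "\<And>x. f x = (1 / real N) * (\<Sum>l = 1..N. F l x)"
    and F_diff: "\<And>l x. l \<in> {1..N} \<Longrightarrow> F l differentiable (at x)"
    and F_bound: "\<And>l x. l \<in> {1..N} \<Longrightarrow> norm (grad (F l) x) \<le> M"
    and diff: "\<And>x. f differentiable (at x)"
    and L: "L > 0" and a: "a \<ge> 0" and E2: "\<And>e. e \<in> E \<Longrightarrow> card e = 2"
    and lip: "\<And>i j x h h'. {i, j} \<in> E \<Longrightarrow>
         norm (grad f (x + axis i h + axis j h') $ i - grad f x $ i,
               grad f (x + axis i h + axis j h') $ j - grad f x $ j) \<le> L * norm (h, h')"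
    and p: "\<And>e. e \<in> E \<Longrightarrow> p e > 0" and p_sum: "(\<Sum>e\<in>E. p e) = 1"
  shows "(\<Sum>(e, l)\<in>E \<times> {1..N}. p e / real N * (f (x - (a / L) *\<^sub>R pair_proj e (grad (F l) x)) - f x))
    \<le> - a * ((\<Sum>e\<in>E. p e * (norm (pair_proj e (grad f x)))\<^sup>2) / L) + M\<^sup>2 / (2 * L) * a\<^sup>2"
proof -
  let ?P = "\<lambda>e l. pair_proj e (grad (F l) x)"
  let ?q = "\<lambda>e. pair_proj e (grad f x)"
  have each: "f (x - (a / L) *\<^sub>R ?P e l) - f x \<le> - (a / L) * (grad f x \<bullet> ?P e l) + M\<^sup>2 / (2 * L) * a\<^sup>2"
    if e: "e \<in> E" and l: "l \<in> {1..N}" for e l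
  proof -
    obtain i j where ij: "e = {i, j}" "i \<noteq> j" using E2[OF e] by (auto simp: card_2_iff)
    have mem: "- (a / L) *\<^sub>R ?P e l \<in> pair_dirs e" by (rule pair_dirs_scaleR[OF pair_proj_mem])
    have "f (x + - (a / L) *\<^sub>R ?P e l) \<le> f x + grad f x \<bullet> (- (a / L) *\<^sub>R ?P e l)
        + L / 2 * (norm (- (a / L) *\<^sub>R ?P e l))\<^sup>2"
      by (rule descent_along_edge[OF diff lip ij(2)]) (use e ij mem in auto)
    also have "(norm (- (a / L) *\<^sub>R ?P e l))\<^sup>2 \<le> ((a / L) * M)\<^sup>2"
    proof (rule power_mono)
      have "norm (?P e l) \<le> M" using norm_pair_proj_le F_bound[OF l] by (rule order_trans)
      then have "(a / L) * norm (?P e l) \<le> (a / L) * M" using a L by (intro mult_left_mono) auto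
      then show "norm (- (a / L) *\<^sub>R ?P e l) \<le> (a / L) * M" using a L by simp
    qed simp
    finally show ?thesis using L by (simp add: power_mult_distrib power_divide) (simp add: power2_eq_square field_simps)
  qed
  \<comment> \<open>By linearity the projected sample gradients average to \<open>?q e\<close>, and
    pairing a vector with its projection gives the squared norm.\<close>
  have inner: "(\<Sum>l = 1..N. grad f x \<bullet> ?P e l) = real N * (norm (?q e))\<^sup>2" for e
  proof -
    have "grad f x = (1 / real N) *\<^sub>R (\<Sum>l = 1..N. grad (F l) x)"
      by (rule grad_average[OF avg]) (use F_diff in auto)
    then have "?q e = (1 / real N) *\<^sub>R (\<Sum>l = 1..N. ?P e l)"
      by (simp add: linear_cmul[OF linear_pair_proj] linear_sum[OF linear_pair_proj])
    then have "(\<Sum>l = 1..N. ?P e l) = real N *\<^sub>R ?q e" using N by simp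
    then show ?thesis by (simp flip: inner_sum_right add: inner_pair_proj_self)
  qed
  have "(\<Sum>(e, l)\<in>E \<times> {1..N}. p e / real N * (f (x - (a / L) *\<^sub>R ?P e l) - f x))
    \<le> (\<Sum>(e, l)\<in>E \<times> {1..N}. p e / real N * (- (a / L) * (grad f x \<bullet> ?P e l) + M\<^sup>2 / (2 * L) * a\<^sup>2))"
  proof (intro sum_mono, clarify)
    fix e l assume "e \<in> E" "l \<in> {1..N}"
    from mult_left_mono[OF each[OF this], of "p e / real N"] p[OF this(1)]
    show "p e / real N * (f (x - (a / L) *\<^sub>R ?P e l) - f x)
      \<le> p e / real N * (- (a / L) * (grad f x \<bullet> ?P e l) + M\<^sup>2 / (2 * L) * a\<^sup>2)"
      by simp
  qed
  also have "\<dots> = (\<Sum>e\<in>E. \<Sum>l = 1..N. p e / real N * (- (a / L) * (grad f x \<bullet> ?P e l) + M\<^sup>2 / (2 * L) * a\<^sup>2))"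
    by (simp add: sum.cartesian_product)
  also have "\<dots> = (\<Sum>e\<in>E. p e * (- (a / L) * (norm (?q e))\<^sup>2 + M\<^sup>2 / (2 * L) * a\<^sup>2))"
  proof (rule sum.cong[OF refl])
    fix e assume "e \<in> E"
    have "(\<Sum>l = 1..N. p e / real N * (- (a / L) * (grad f x \<bullet> ?P e l) + M\<^sup>2 / (2 * L) * a\<^sup>2))
      = p e / real N * (- (a / L) * (\<Sum>l = 1..N. grad f x \<bullet> ?P e l) + real N * (M\<^sup>2 / (2 * L) * a\<^sup>2))"
      by (simp only: sum_distrib_left[symmetric] sum.distrib) simp
    also have "\<dots> = p e * (- (a / L) * (norm (?q e))\<^sup>2 + M\<^sup>2 / (2 * L) * a\<^sup>2)"
      using N unfolding inner by (simp add: field_simps)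
    finally show "(\<Sum>l = 1..N. p e / real N * (- (a / L) * (grad f x \<bullet> ?P e l) + M\<^sup>2 / (2 * L) * a\<^sup>2))
      = p e * (- (a / L) * (norm (?q e))\<^sup>2 + M\<^sup>2 / (2 * L) * a\<^sup>2)" .
  qed
  also have "\<dots> = - (a / L) * (\<Sum>e\<in>E. p e * (norm (?q e))\<^sup>2) + (\<Sum>e\<in>E. p e) * (M\<^sup>2 / (2 * L) * a\<^sup>2)"
    by (simp only: distrib_left sum.distrib sum_distrib_left sum_distrib_right mult.left_commute)
  finally show ?thesis by (simp add: p_sum)
qed


section \<open>Integrability, feasibility and moments\<close>

text \<open>The best iterate is an arbitrary selection among minimizers, but its value is this
  running minimum; integrability is obtained through the value.\<close>

lemma (in finite_noise_process) integrable_running_Min: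
  fixes h :: "'x \<Rightarrow> real"
  shows "integrable \<Omega> (\<lambda>\<omega>. Min ((\<lambda>i. h (X i \<omega>)) ` {0..k}))"
proof (induction k)
  case 0
  then show ?case by (simp add: integrable_process)
next
  case (Suc k)
  have "Min ((\<lambda>i. h (X i \<omega>)) ` {0..Suc k}) = min (h (X (Suc k) \<omega>)) (Min ((\<lambda>i. h (X i \<omega>)) ` {0..k}))" for \<omega>
    by (simp add: atLeastAtMostSuc_conv)
  then show ?case
    using Suc by (simp add: Bochner_Integration.integrable_min integrable_process)
qed

lemma pair_dirs_subset_feasible: "pair_dirs e \<subseteq> feasible"
proof
  fix d assume d: "d \<in> pair_dirs e"
  then have "(\<Sum>r\<in>UNIV. fst (d $ r)) = (\<Sum>r\<in>e. fst (d $ r))"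
    by (intro sum.mono_neutral_right) (auto simp: pair_dirs_def)
  with d show "d \<in> feasible" by (simp add: feasible_def pair_dirs_def)
qed

lemma feasible_diff: "x \<in> feasible \<Longrightarrow> d \<in> feasible \<Longrightarrow> x - d \<in> feasible"
  by (simp add: feasible_def sum_subtractf)

lemma norm_grad_average_le:
  fixes F :: "nat \<Rightarrow> 'a::euclidean_space \<Rightarrow> real"
  assumes N: "N \<ge> 1" and avg: "\<And>x. f x = (1 / real N) * (\<Sum>l = 1..N. F l x)"
    and F_diff: "\<And>l. l \<in> {1..N} \<Longrightarrow> F l differentiable (at x)"
    and F_bound: "\<And>l. l \<in> {1..N} \<Longrightarrow> norm (grad (F l) x) \<le> M"
  shows "norm (grad f x) \<le> M"
proof -
  have "grad f x = (1 / real N) *\<^sub>R (\<Sum>l = 1..N. grad (F l) x)"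
    by (rule grad_average[OF avg]) (use F_diff in auto)
  moreover have "norm (\<Sum>l = 1..N. grad (F l) x) \<le> real N * M"
    using sum_norm_le[of "{1..N}" "\<lambda>l. grad (F l) x" "\<lambda>_. M"] F_bound by simp
  ultimately show ?thesis using N by (simp add: field_simps)
qed

text \<open>One step of the squared gap: \<open>a\<close> is the present gap,
  \<open>\<delta>\<close> its random change, \<open>\<eta>\<close> a bound on the mean change from
  descent, \<open>b\<close> a bound on its size.\<close>

lemma weighted_second_moment_le:
  fixes w \<delta> :: "'s \<Rightarrow> real"
  assumes "\<And>s. s \<in> S \<Longrightarrow> w s \<ge> 0" "(\<Sum>s\<in>S. w s) = 1" "\<And>s. s \<in> S \<Longrightarrow> \<bar>\<delta> s\<bar> \<le> b"
    and "(\<Sum>s\<in>S. w s * \<delta> s) \<le> \<eta>" "a \<ge> 0"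
  shows "(\<Sum>s\<in>S. w s * (a + \<delta> s)\<^sup>2) \<le> a\<^sup>2 + 2 * a * \<eta> + b\<^sup>2"
proof -
  have "(\<Sum>s\<in>S. w s * (a + \<delta> s)\<^sup>2) \<le> (\<Sum>s\<in>S. w s * (a\<^sup>2 + b\<^sup>2) + 2 * a * (w s * \<delta> s))"
  proof (rule sum_mono)
    fix s assume s: "s \<in> S"
    have "(\<delta> s)\<^sup>2 \<le> b\<^sup>2" using power_mono[OF assms(3)[OF s] abs_ge_zero, of 2] by simp
    then have "w s * (a + \<delta> s)\<^sup>2 \<le> w s * (a\<^sup>2 + 2 * a * \<delta> s + b\<^sup>2)"
      using assms(1)[OF s] by (intro mult_left_mono) (simp add: power2_sum)
    then show "w s * (a + \<delta> s)\<^sup>2 \<le> w s * (a\<^sup>2 + b\<^sup>2) + 2 * a * (w s * \<delta> s)"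
      by (simp add: algebra_simps)
  qed
  also have "\<dots> = (\<Sum>s\<in>S. w s) * (a\<^sup>2 + b\<^sup>2) + 2 * a * (\<Sum>s\<in>S. w s * \<delta> s)"
    by (simp only: sum.distrib sum_distrib_left sum_distrib_right)
  also have "\<dots> \<le> a\<^sup>2 + b\<^sup>2 + 2 * a * \<eta>"
    using mult_left_mono[OF assms(4), of "2 * a"] assms(2,5) by simp
  finally show ?thesis by simp
qed

text \<open>Averaging \<open>v\<^sup>2 \<le> (m i)\<^sup>2\<close> over the \<open>k + 1\<close>
  indices bounds the second moment of \<open>v\<close> by C/sqrt (k + 1). The inequality v \<le> t/2
  + v^2/(2t) converts this to a first moment, and t = k^(-1/4) balances its terms.\<close>

lemma (in prob_space) expectation_le_quarter_power:
  fixes v :: "'a \<Rightarrow> real" and m :: "nat \<Rightarrow> 'a \<Rightarrow> real"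
  assumes k: "k \<ge> 1"
    and v: "integrable M v" "\<And>\<omega>. \<omega> \<in> space M \<Longrightarrow> 0 \<le> v \<omega>"
    and m: "\<And>i. i \<le> k \<Longrightarrow> integrable M (\<lambda>\<omega>. (m i \<omega>)\<^sup>2)"
    and vm: "\<And>i \<omega>. i \<le> k \<Longrightarrow> \<omega> \<in> space M \<Longrightarrow> v \<omega> \<le> m i \<omega>"
    and sum: "(\<Sum>i<Suc k. expectation (\<lambda>\<omega>. (m i \<omega>)\<^sup>2)) \<le> C * sqrt (real (Suc k))" and C: "C \<ge> 0"
  shows "expectation v \<le> (1 + C) / 2 * real k powr (- 1 / 4)"
proof -
  define t where "t = real k powr (- 1 / 4)"
  have t: "t > 0" using k by (simp add: t_def)
  have t2: "t\<^sup>2 = 1 / sqrt (real k)"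
  proof -
    have "t\<^sup>2 = real k powr (- (1 / 2))" by (simp add: t_def power2_eq_square flip: powr_add)
    then show ?thesis using k by (simp add: powr_minus_divide powr_half_sqrt)
  qed
  let ?S = "\<lambda>\<omega>. \<Sum>i<Suc k. (m i \<omega>)\<^sup>2"
  have "v \<omega> \<le> t / 2 + ?S \<omega> / (2 * t * real (Suc k))" if \<omega>: "\<omega> \<in> space M" for \<omega>
  proof -
    have "(\<Sum>i<Suc k. (v \<omega>)\<^sup>2) \<le> ?S \<omega>"
      using v(2)[OF \<omega>] vm \<omega> by (intro sum_mono power_mono) auto
    then have "real (Suc k) * (v \<omega>)\<^sup>2 \<le> ?S \<omega>" by simp
    then have "real (Suc k) * (v \<omega>)\<^sup>2 / (2 * t * real (Suc k)) \<le> ?S \<omega> / (2 * t * real (Suc k))"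
      using t by (intro divide_right_mono) auto
    then have "(v \<omega>)\<^sup>2 / (2 * t) \<le> ?S \<omega> / (2 * t * real (Suc k))"
      by (simp del: sum.lessThan_Suc of_nat_Suc)
    moreover have "0 \<le> (v \<omega> - t)\<^sup>2 / (2 * t)" using t by simp
    then have "v \<omega> \<le> t / 2 + (v \<omega>)\<^sup>2 / (2 * t)"
      using t by (simp add: power2_diff field_simps power2_eq_square)
    ultimately show ?thesis by simp
  qed
  then have "expectation v \<le> expectation (\<lambda>\<omega>. t / 2 + ?S \<omega> / (2 * t * real (Suc k)))"
    using v(1) m by (intro integral_mono Bochner_Integration.integrable_add integrable_divide
        Bochner_Integration.integrable_sum) auto
  also have "\<dots> = t / 2 + (\<Sum>i<Suc k. expectation (\<lambda>\<omega>. (m i \<omega>)\<^sup>2)) / (2 * t * real (Suc k))"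
  proof -
    have "integrable M ?S" using m by (intro Bochner_Integration.integrable_sum) auto
    moreover have "expectation ?S = (\<Sum>i<Suc k. expectation (\<lambda>\<omega>. (m i \<omega>)\<^sup>2))"
      using m by (intro Bochner_Integration.integral_sum) auto
    ultimately show ?thesis by (simp add: prob_space del: sum.lessThan_Suc)
  qed
  also have "\<dots> \<le> t / 2 + C * sqrt (real (Suc k)) / (2 * t * real (Suc k))"
    using t sum by (intro add_left_mono divide_right_mono) auto
  also have "C * sqrt (real (Suc k)) / (2 * t * real (Suc k)) = C / (2 * t) * (1 / sqrt (real (Suc k)))"
  proof -
    have "real (Suc k) = sqrt (real (Suc k)) * sqrt (real (Suc k))" by simp
    then show ?thesis using t by (simp add: divide_simps)
  qed
  also have "\<dots> \<le> C / (2 * t) * t\<^sup>2"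
    unfolding t2 using k C t by (intro mult_left_mono divide_left_mono) auto
  also have "\<dots> = C / 2 * t" using t by (simp add: power2_eq_square)
  finally show ?thesis by (simp add: t_def field_simps)
qed

section \<open>Drift and moment recursions along the iterates, and the rate\<close>

theorem theorem5:
  fixes F :: "nat \<Rightarrow> ('y::finite, 'z::finite, 'b::finite) point \<Rightarrow> real"
    and f :: "('y, 'z, 'b) point \<Rightarrow> real"
    and N :: nat and M L \<Delta>\<^sub>0 :: real
    and E :: "'b set set" and p :: "'b set \<Rightarrow> real"
    and x0 :: "('y, 'z, 'b) point"
    and \<alpha> :: "nat \<Rightarrow> real"
    and \<Omega> :: "'w measure"
    and edge :: "nat \<Rightarrow> 'w \<Rightarrow> 'b set" and idx :: "nat \<Rightarrow> 'w \<Rightarrow> nat"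
    and X xbar :: "nat \<Rightarrow> 'w \<Rightarrow> ('y, 'z, 'b) point"
  assumes N_pos: "N \<ge> 1"
    and f_avg: "\<And>x. f x = (1 / real N) * (\<Sum>l = 1..N. F l x)"
    and F_diff: "\<And>l x. l \<in> {1..N} \<Longrightarrow> F l differentiable (at x)"
    and F_grad_bound: "\<And>l x. l \<in> {1..N} \<Longrightarrow> norm (grad (F l) x) \<le> M"
    and f_convex: "convex_on UNIV f"
    and f_diff: "\<And>x. f differentiable (at x)"
    and f_C1: "continuous_on UNIV (grad f)"
    and opt_nonempty: "opt_set f \<noteq> {}"
    and L_pos: "L > 0"
    and block_lipschitz:
      "\<And>i x h. norm (grad f (x + axis i h) $ i - grad f x $ i) \<le> L * norm h"
    and edge_lipschitz:
      "\<And>i j x h h'. {i, j} \<in> E \<Longrightarrow>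
         norm (grad f (x + axis i h + axis j h') $ i - grad f x $ i,
               grad f (x + axis i h + axis j h') $ j - grad f x $ j) \<le> L * norm (h, h')"
    and graph: "connected_graph E"
    and p_pos: "\<And>e. e \<in> E \<Longrightarrow> p e > 0"
    and p_nonedge: "\<And>e. e \<notin> E \<Longrightarrow> p e = 0"
    and p_sum: "(\<Sum>e\<in>E. p e) = 1"
    and x0_feasible: "x0 \<in> feasible"
    and radius_finite:
      "bdd_above ((\<lambda>(x, xs). K_dual_norm p L (x - xs)) ` ({x. f x \<le> f x0} \<times> opt_set f))"
    and Delta0: "\<Delta>\<^sub>0 = f x0 - opt_val f"
    and step_sizes: "\<And>i. \<alpha> i = sqrt (\<Delta>\<^sub>0 * L) / (M * sqrt (real i + 1))"
    and prob: "prob_space \<Omega>"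
    and draws_indep:
      "prob_space.indep_vars \<Omega> (\<lambda>_. count_space (E \<times> {1..N})) (\<lambda>k \<omega>. (edge k \<omega>, idx k \<omega>)) UNIV"
    and draws_law:
      "\<And>k e l. e \<in> E \<Longrightarrow> l \<in> {1..N} \<Longrightarrow>
         measure \<Omega> {\<omega> \<in> space \<Omega>. edge k \<omega> = e \<and> idx k \<omega> = l} = p e * (1 / real N)"
    and X_0: "\<And>\<omega>. \<omega> \<in> space \<Omega> \<Longrightarrow> X 0 \<omega> = x0"
    and X_Suc: "\<And>k \<omega>. \<omega> \<in> space \<Omega> \<Longrightarrow>
      \<exists>d. is_pair_step L (\<alpha> k) (F (idx k \<omega>)) (edge k \<omega>) (X k \<omega>) d \<and> X (Suc k) \<omega> = X k \<omega> + d"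
    and xbar: "\<And>k \<omega>. \<omega> \<in> space \<Omega> \<Longrightarrow>
      is_arg_min f (\<lambda>x. x \<in> (\<lambda>i. X i \<omega>) ` {0..k}) (xbar k \<omega>)"
  shows "(\<forall>k. integrable \<Omega> (\<lambda>\<omega>. f (xbar k \<omega>))) \<and>
    (\<exists>C. \<forall>k\<ge>1. (LINT \<omega>|\<Omega>. f (xbar k \<omega>)) - opt_val f \<le> C * real k powr (- 1 / 4))"
proof -
  interpret prob_space \<Omega> by (rule prob)
  obtain xs where xs: "xs \<in> opt_set f" using opt_nonempty by blast
  then have xs_feas: "xs \<in> feasible" and opt: "\<And>u. u \<in> feasible \<Longrightarrow> f xs \<le> f u"
    by (auto simp: opt_set_def is_arg_min_linorder)
  have opt_val: "opt_val f = f xs"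
    unfolding opt_val_def using xs_feas opt by (intro cInf_eq_minimum) auto
  have M: "M \<ge> 0"
    using N_pos by (intro order_trans[OF norm_ge_zero F_grad_bound[of 1 x0]]) simp
  have D0: "\<Delta>\<^sub>0 \<ge> 0" using opt[OF x0_feasible] by (simp add: Delta0 opt_val)
  define \<kappa> where "\<kappa> = sqrt (\<Delta>\<^sub>0 * L) / M"
  have \<kappa>: "\<kappa> \<ge> 0" using M D0 L_pos by (simp add: \<kappa>_def)
  have \<alpha>: "\<alpha> n = \<kappa> / sqrt (real n + 1)" for n by (simp add: step_sizes \<kappa>_def)
  have \<alpha>0: "0 \<le> \<alpha> n" for n using \<kappa> by (simp add: \<alpha>)
  have E2: "\<And>e. e \<in> E \<Longrightarrow> card e = 2" using graph by (simp add: connected_graph_def)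
  have Ene: "E \<noteq> {}" using p_sum by auto
  define S where "S = E \<times> {1..N}"
  define w where "w s = p (fst s) / real N" for s :: "'b set \<times> nat"
  define step where "step n x s = x - (\<alpha> n / L) *\<^sub>R pair_proj (fst s) (grad (F (snd s)) x)"
    for n x and s :: "'b set \<times> nat"
  have w0: "w s \<ge> 0" if "s \<in> S" for s
    using that p_pos by (auto simp: w_def S_def intro!: divide_nonneg_nonneg less_imp_le)
  have w1: "(\<Sum>s\<in>S. w s) = 1"
  proof -
    have "(\<Sum>s\<in>S. w s) = (\<Sum>e\<in>E. \<Sum>l = 1..N. p e / real N)"
      unfolding w_def S_def by (simp add: sum.cartesian_product case_prod_unfold del: sum_constant)
    then show ?thesis using N_pos p_sum by simp
  qed
  interpret W: finite_noise_process \<Omega> S w "\<lambda>k \<omega>. (edge k \<omega>, idx k \<omega>)" X x0 step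
  proof unfold_locales
    show "finite S" by (simp add: S_def)
    show "indep_vars (\<lambda>_. count_space S) (\<lambda>k \<omega>. (edge k \<omega>, idx k \<omega>)) UNIV"
      using draws_indep by (simp add: S_def)
    show "prob {\<omega> \<in> space \<Omega>. (edge k \<omega>, idx k \<omega>) = s} = w s" if "s \<in> S" for k s
      using draws_law[of "fst s" "snd s" k] that by (cases s) (auto simp: S_def w_def)
    show "X 0 \<omega> = x0" if "\<omega> \<in> space \<Omega>" for \<omega> using X_0[OF that] .
    \<comment> \<open>The subproblem has a unique solution, so the existentially given increment is
      a function of iterate and draw.\<close>
    show "X (Suc k) \<omega> = step k (X k \<omega>) (edge k \<omega>, idx k \<omega>)" if "\<omega> \<in> space \<Omega>" for k \<omega>
      using X_Suc[OF that, of k] is_pair_step_eq[OF L_pos \<alpha>0] by (auto simp: step_def)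
  qed
  have step_feas: "step n x s \<in> feasible" if "x \<in> feasible" for n x s
    unfolding step_def using that subsetD[OF pair_dirs_subset_feasible pair_dirs_scaleR[OF pair_proj_mem]]
    by (rule feasible_diff)
  have feas: "X k \<omega> \<in> feasible" if "\<omega> \<in> space \<Omega>" for k \<omega>
    by (induction k) (simp_all add: W.process_0 W.process_Suc that x0_feasible step_feas)
  have lipf: "\<bar>f (x + d) - f x\<bar> \<le> M * norm d" for x d
    using f_diff norm_grad_average_le[OF N_pos f_avg F_diff F_grad_bound]
    by (rule norm_grad_bound_imp_lipschitz)
  define a where "a x = f x - f xs" for x
  have a0: "a x \<ge> 0" if "x \<in> feasible" for x using opt[OF that] by (simp add: a_def)
  have xbar_le: "f (xbar k \<omega>) = Min ((\<lambda>i. f (X i \<omega>)) ` {0..k})" if \<omega>: "\<omega> \<in> space \<Omega>" for k \<omega>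
  proof (rule Min_eqI[symmetric])
    show "f (xbar k \<omega>) \<in> (\<lambda>i. f (X i \<omega>)) ` {0..k}" "\<And>y. y \<in> (\<lambda>i. f (X i \<omega>)) ` {0..k} \<Longrightarrow> f (xbar k \<omega>) \<le> y"
      using xbar[OF \<omega>, of k] by (auto simp: is_arg_min_linorder)
  qed simp
  have int_xbar: "integrable \<Omega> (\<lambda>\<omega>. f (xbar k \<omega>))" for k
    using W.integrable_running_Min[of f k] xbar_le
    by (rule Bochner_Integration.integrable_cong[THEN iffD2, OF refl, rotated])
  have xbar_X: "f (xbar k \<omega>) \<le> f (X i \<omega>)" if "\<omega> \<in> space \<Omega>" "i \<le> k" for k i \<omega>
    using that by (simp add: xbar_le)
  have xbar_opt: "f xs \<le> f (xbar k \<omega>)" if "\<omega> \<in> space \<Omega>" for k \<omega>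
    using that feas by (simp add: xbar_le opt)
  have gap: "(LINT \<omega>|\<Omega>. f (xbar k \<omega>)) - opt_val f = expectation (\<lambda>\<omega>. f (xbar k \<omega>) - f xs)" for k
    by (simp add: opt_val int_xbar prob_space)
  have "\<exists>C. \<forall>k\<ge>1. expectation (\<lambda>\<omega>. f (xbar k \<omega>) - f xs) \<le> C * real k powr (- 1 / 4)"
  proof (cases "\<Delta>\<^sub>0 = 0")
    case True
    have "f (xbar k \<omega>) - f xs = 0" if "\<omega> \<in> space \<Omega>" for k \<omega>
      using xbar_X[OF that, of 0 k] xbar_opt[OF that, of k] True
      by (simp add: X_0[OF that] Delta0 opt_val)
    then have "expectation (\<lambda>\<omega>. f (xbar k \<omega>) - f xs) = 0" for k
      by (simp cong: Bochner_Integration.integral_cong)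
    then show ?thesis by (intro exI[of _ 0]) simp
  next
    case False
    then have D0: "\<Delta>\<^sub>0 > 0" using D0 by simp
    \<comment> \<open>With \<open>M = 0\<close> the function would be constant, against a positive
      initial gap. This rules out the zero step sizes that division by 0 would produce.\<close>
    have M: "M > 0"
    proof (rule ccontr)
      assume "\<not> M > 0"
      then have "f (xs + (x0 - xs)) = f xs" using M lipf[of xs "x0 - xs"] by simp
      then show False using D0 by (simp add: Delta0 opt_val)
    qed
    have \<kappa>: "\<kappa> > 0" using M D0 L_pos by (simp add: \<kappa>_def)
    define m where "m x = min (a x) \<Delta>\<^sub>0" for x
    obtain R0 where R0: "\<And>u. f u \<le> f x0 \<Longrightarrow> K_dual_norm p L (u - xs) \<le> R0"
      using radius_finite xs unfolding bdd_above_def by force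
    \<comment> \<open>The maximum with 1 makes the radius positive, so that \<open>c\<close> below
      is positive.\<close>
    define R where "R = max R0 1"
    have R: "R > 0" "\<And>u. f u \<le> f x0 \<Longrightarrow> K_dual_norm p L (u - xs) \<le> R"
      using R0 by (force simp: R_def)+
    define c where "c = 1 / R\<^sup>2"
    define C where "C = M\<^sup>2 / (2 * L)"
    define B where "B = M\<^sup>2 / L"
    have cCB: "c > 0" "C \<ge> 0" "B \<ge> 0" using R(1) L_pos by (simp_all add: c_def C_def B_def)
    define \<delta> where "\<delta> n x s = f (step n x s) - f x" for n x s
    have mean: "(\<Sum>s\<in>S. w s * \<delta> n x s) \<le> - c * \<alpha> n * (m x)\<^sup>2 + C * (\<alpha> n)\<^sup>2" if x: "x \<in> feasible" for n x
    proof -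
      let ?G = "(\<Sum>e\<in>E. p e * (norm (pair_proj e (grad f x)))\<^sup>2) / L"
      have G0: "?G \<ge> 0" using p_pos[THEN less_imp_le] L_pos
        by (auto intro!: sum_nonneg divide_nonneg_nonneg mult_nonneg_nonneg)
      have "m x \<le> R * sqrt ?G"
        unfolding m_def a_def Delta0 opt_val
        by (rule truncated_gap_le[OF f_diff f_convex L_pos graph p_pos p_nonedge Ene x xs_feas
              opt[OF x] opt[OF x0_feasible] R(2)])
      then have "(m x)\<^sup>2 \<le> (R * sqrt ?G)\<^sup>2"
        using a0[OF x] D0 by (intro power_mono) (auto simp: m_def)
      then have "(m x)\<^sup>2 \<le> R\<^sup>2 * ?G" using G0 by (simp add: power_mult_distrib)
      then have "c * (m x)\<^sup>2 \<le> ?G" using R(1) by (simp add: c_def field_simps)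
      then have "\<alpha> n * (c * (m x)\<^sup>2) \<le> \<alpha> n * ?G" using \<alpha>0 by (rule mult_left_mono)
      moreover have "(\<Sum>s\<in>S. w s * \<delta> n x s) \<le> - \<alpha> n * ?G + M\<^sup>2 / (2 * L) * (\<alpha> n)\<^sup>2"
        using expected_descent[OF N_pos f_avg F_diff F_grad_bound f_diff L_pos \<alpha>0 E2 edge_lipschitz p_pos p_sum,
            where x = x]
        by (simp add: S_def w_def \<delta>_def step_def case_prod_beta)
      ultimately show ?thesis by (simp add: C_def mult_ac)
    qed
    have \<delta>: "\<bar>\<delta> n x s\<bar> \<le> B * \<alpha> n" if "s \<in> S" for n x s
    proof -
      let ?d = "- (\<alpha> n / L) *\<^sub>R pair_proj (fst s) (grad (F (snd s)) x)"
      have "norm (pair_proj (fst s) (grad (F (snd s)) x)) \<le> M"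
        by (rule order_trans[OF norm_pair_proj_le F_grad_bound]) (use that in \<open>auto simp: S_def\<close>)
      then have "norm ?d \<le> \<alpha> n / L * M"
        using \<alpha>0[of n] L_pos by (simp add: divide_right_mono mult_left_mono)
      then have "M * norm ?d \<le> M * (\<alpha> n / L * M)" using M by (intro mult_left_mono) auto
      then show ?thesis
        using lipf[of x ?d] by (simp add: \<delta>_def step_def B_def power2_eq_square mult_ac)
    qed
    \<comment> \<open>Each step changes the gap by at most \<open>B * \<alpha> n\<close>, so on
      every path the gap is at most \<open>\<Delta>\<^sub>0\<close> plus a multiple of sqrt n, which
      the factor \<open>\<alpha> n\<close> compensates.\<close>
    define P where "P = \<kappa> * \<Delta>\<^sub>0 + 2 * B * \<kappa>\<^sup>2"
    have P: "\<alpha> n * a (X n \<omega>) \<le> P" if \<omega>: "\<omega> \<in> space \<Omega>" for n \<omega>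
    proof -
      have "a (X n \<omega>) \<le> \<Delta>\<^sub>0 + B * \<kappa> * (\<Sum>i<n. 1 / sqrt (real i + 1))"
      proof (induction n)
        case 0
        then show ?case by (simp add: X_0[OF \<omega>] a_def Delta0 opt_val)
      next
        case (Suc n)
        have "a (X (Suc n) \<omega>) \<le> a (X n \<omega>) + B * \<alpha> n"
          using \<delta>[OF W.noise_in[OF \<omega>], of n "X n \<omega>" n] by (simp add: a_def \<delta>_def W.process_Suc[OF \<omega>])
        then show ?case using Suc by (simp add: \<alpha> algebra_simps)
      qed
      also have "\<dots> \<le> \<Delta>\<^sub>0 + B * \<kappa> * (2 * sqrt (real n))"
        using cCB \<kappa> by (intro add_left_mono mult_left_mono sum_inverse_sqrt_le) auto
      finally have "\<alpha> n * a (X n \<omega>) \<le> \<alpha> n * (\<Delta>\<^sub>0 + B * \<kappa> * (2 * sqrt (real n)))"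
        using \<alpha>0 by (intro mult_left_mono)
      also have "\<dots> = \<kappa> * \<Delta>\<^sub>0 * (1 / sqrt (real n + 1)) + 2 * B * \<kappa>\<^sup>2 * (sqrt (real n) / sqrt (real n + 1))"
        by (simp add: \<alpha> algebra_simps power2_eq_square)
      also have "\<dots> \<le> \<kappa> * \<Delta>\<^sub>0 * 1 + 2 * B * \<kappa>\<^sup>2 * 1"
        using cCB \<kappa> D0 by (intro add_mono mult_left_mono) auto
      finally show ?thesis by (simp add: P_def)
    qed
    \<comment> \<open>The three terms pay for replacing a m^2 by a linear function of the gap, for
      the descent error multiplied by the gap, and for the squared change, using \<alpha> \<le>
      \<kappa>.\<close>
    define K where "K = 2 * c * \<Delta>\<^sub>0 ^ 3 + 2 * C * P + B\<^sup>2 * \<kappa>"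
    \<comment> \<open>The bound by \<open>P\<close> holds along trajectories only, so it is a
      premise here and is discharged at \<open>X n \<omega>\<close> under the expectation.\<close>
    have second: "(\<Sum>s\<in>S. w s * (a (step n x s))\<^sup>2) \<le> (a x)\<^sup>2 - 2 * c * \<Delta>\<^sub>0\<^sup>2 * \<alpha> n * a x + K * \<alpha> n"
      if x: "x \<in> feasible" and P: "\<alpha> n * a x \<le> P" for n x
    proof -
      let ?\<eta> = "- c * \<alpha> n * (m x)\<^sup>2 + C * (\<alpha> n)\<^sup>2"
      have "(\<Sum>s\<in>S. w s * (a x + \<delta> n x s)\<^sup>2) \<le> (a x)\<^sup>2 + 2 * a x * ?\<eta> + (B * \<alpha> n)\<^sup>2"
        using w0 w1 \<delta> mean[OF x] a0[OF x] by (rule weighted_second_moment_le)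
      moreover have "a x + \<delta> n x s = a (step n x s)" for s by (simp add: a_def \<delta>_def)
      moreover have "2 * a x * ?\<eta> + (B * \<alpha> n)\<^sup>2 \<le> - (2 * c * \<Delta>\<^sub>0\<^sup>2 * \<alpha> n * a x) + K * \<alpha> n"
      proof -
        \<comment> \<open>Up to \<open>\<Delta>\<^sub>0\<close> the left side is not positive;
          beyond it \<open>m x = \<Delta>\<^sub>0\<close>. So the drift of the squared gap is linear
          in the untruncated gap, up to a constant.\<close>
        have "\<Delta>\<^sub>0\<^sup>2 * (a x - \<Delta>\<^sub>0) \<le> a x * (m x)\<^sup>2"
        proof (cases "a x \<le> \<Delta>\<^sub>0")
          case True
          then have "\<Delta>\<^sub>0\<^sup>2 * (a x - \<Delta>\<^sub>0) \<le> 0" by (simp add: mult_nonneg_nonpos)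
          also have "0 \<le> a x * (m x)\<^sup>2" using a0[OF x] by simp
          finally show ?thesis .
        next
          case False
          then show ?thesis using D0 by (simp add: m_def algebra_simps)
        qed
        then have "2 * c * \<alpha> n * (\<Delta>\<^sub>0\<^sup>2 * (a x - \<Delta>\<^sub>0)) \<le> 2 * c * \<alpha> n * (a x * (m x)\<^sup>2)"
          using cCB \<alpha>0 by (intro mult_left_mono) auto
        moreover have "2 * C * \<alpha> n * (\<alpha> n * a x) \<le> 2 * C * \<alpha> n * P"
          using cCB \<alpha>0 P by (intro mult_left_mono) auto
        moreover have "B\<^sup>2 * \<alpha> n * \<alpha> n \<le> B\<^sup>2 * \<alpha> n * \<kappa>"
          using \<alpha>0[of n] \<kappa> by (intro mult_left_mono) (auto simp: \<alpha> divide_le_eq)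
        ultimately show ?thesis by (simp add: K_def algebra_simps power2_eq_square power3_eq_cube)
      qed
      ultimately show ?thesis by simp
    qed
    define A where "A n = expectation (\<lambda>\<omega>. a (X n \<omega>))" for n
    define V where "V n = expectation (\<lambda>\<omega>. (m (X n \<omega>))\<^sup>2)" for n
    define Q where "Q n = expectation (\<lambda>\<omega>. (a (X n \<omega>))\<^sup>2)" for n
    have int: "integrable \<Omega> (\<lambda>\<omega>. h (X n \<omega>))" for h :: "_ \<Rightarrow> real" and n by (rule W.integrable_process)
    have A_Suc: "A (Suc n) \<le> A n - c * (\<kappa> / sqrt (real n + 1)) * V n + C * (\<kappa> / sqrt (real n + 1))\<^sup>2" for n
    proof -
      have "A (Suc n) = expectation (\<lambda>\<omega>. \<Sum>s\<in>S. w s * a (step n (X n \<omega>) s))"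
        unfolding A_def by (rule W.expectation_process_Suc)
      also have "\<dots> \<le> expectation (\<lambda>\<omega>. a (X n \<omega>) - c * \<alpha> n * (m (X n \<omega>))\<^sup>2 + C * (\<alpha> n)\<^sup>2)"
      proof (rule integral_mono[OF int int])
        fix \<omega> assume \<omega>: "\<omega> \<in> space \<Omega>"
        have "(\<Sum>s\<in>S. w s * a (step n (X n \<omega>) s)) = (\<Sum>s\<in>S. w s * a (X n \<omega>) + w s * \<delta> n (X n \<omega>) s)"
          by (simp add: a_def \<delta>_def algebra_simps)
        also have "\<dots> = a (X n \<omega>) + (\<Sum>s\<in>S. w s * \<delta> n (X n \<omega>) s)"
          by (simp add: sum.distrib w1 flip: sum_distrib_right)
        finally show "(\<Sum>s\<in>S. w s * a (step n (X n \<omega>) s))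
            \<le> a (X n \<omega>) - c * \<alpha> n * (m (X n \<omega>))\<^sup>2 + C * (\<alpha> n)\<^sup>2"
          using mean[OF feas[OF \<omega>], of n n] by simp
      qed
      also have "\<dots> = A n - c * \<alpha> n * V n + C * (\<alpha> n)\<^sup>2"
        using int[of a] int[of "\<lambda>x. (m x)\<^sup>2"] by (simp add: A_def V_def prob_space)
      finally show ?thesis by (simp add: \<alpha>)
    qed
    have Q_Suc: "Q (Suc n) \<le> Q n - 2 * c * \<Delta>\<^sub>0\<^sup>2 * (\<kappa> / sqrt (real n + 1)) * A n
        + K * (\<kappa> / sqrt (real n + 1))" for n
    proof -
      have "Q (Suc n) = expectation (\<lambda>\<omega>. \<Sum>s\<in>S. w s * (a (step n (X n \<omega>) s))\<^sup>2)"
        unfolding Q_def by (rule W.expectation_process_Suc)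
      also have "\<dots> \<le> expectation (\<lambda>\<omega>. (a (X n \<omega>))\<^sup>2 - 2 * c * \<Delta>\<^sub>0\<^sup>2 * \<alpha> n * a (X n \<omega>) + K * \<alpha> n)"
        by (rule integral_mono[OF int int]) (intro second feas P)
      also have "\<dots> = Q n - 2 * c * \<Delta>\<^sub>0\<^sup>2 * \<alpha> n * A n + K * \<alpha> n"
        using int[of a] int[of "\<lambda>x. (a x)\<^sup>2"] by (simp add: A_def Q_def prob_space)
      finally show ?thesis by (simp add: \<alpha>)
    qed
    have "A n \<ge> 0" "Q n \<ge> 0" for n
      unfolding A_def Q_def by (auto intro!: Bochner_Integration.integral_nonneg a0 feas)
    moreover have "2 * c * \<Delta>\<^sub>0\<^sup>2 > 0" using cCB D0 by simp
    moreover have "K \<ge> 0" using cCB D0 \<kappa> by (simp add: K_def P_def)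
    ultimately obtain C' where C': "C' \<ge> 0" "\<And>n. (\<Sum>i<n. V i) \<le> C' * sqrt (real n)"
      using sum_le_sqrt_of_two_recursions[OF \<kappa> cCB(1) _ cCB(2) _ _ _ A_Suc Q_Suc] by blast
    have "expectation (\<lambda>\<omega>. f (xbar k \<omega>) - f xs) \<le> (1 + C') / 2 * real k powr (- 1 / 4)" if k: "k \<ge> 1" for k
    proof (rule expectation_le_quarter_power[OF k, where m = "\<lambda>i \<omega>. m (X i \<omega>)"])
      \<comment> \<open>Comparison with iterate \<open>i\<close> gives the bound by the gap,
        comparison with iterate 0 the bound by \<open>\<Delta>\<^sub>0\<close>.\<close>
      show "f (xbar k \<omega>) - f xs \<le> m (X i \<omega>)" if "i \<le> k" "\<omega> \<in> space \<Omega>" for i \<omega>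
        using xbar_X[OF that(2,1)] xbar_X[OF that(2), of 0 k]
        by (simp add: m_def a_def Delta0 opt_val X_0[OF that(2)])
      show "(\<Sum>i<Suc k. expectation (\<lambda>\<omega>. (m (X i \<omega>))\<^sup>2)) \<le> C' * sqrt (real (Suc k))"
        using C'(2)[of "Suc k"] by (simp only: V_def)
    qed (use int_xbar xbar_opt int C'(1) in auto)
    then show ?thesis by blast
  qed
  then show ?thesis using int_xbar by (simp add: gap)
qed

end
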